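(* Every signed graph $G$ with maximum average degree $\mathrm{mad}(G) < \frac{17}{5}$ admits a homomorphism to the signed graph $SP_9^+$. That is, $\chi_s(\mathcal{M}_{\frac{17}{5}}) \le 10$.
   Context: A signed graph $G=(V,E,s)$ is a finite simple graph $(V,E)$ (no loops, no parallel edges) together with a signature $s:E\to\{-1,+1\}$; edges with sign $+1$ are positive, with sign $-1$ negative. Switching a vertex $v$ reverses the sign of every edge incident to $v$; two signed graphs are switching equivalent if one can be obtained from the other by a sequence of switches. For signed graphs $G$ and $H$, a map $\varphi:V(G)\to V(H)$ is a homomorphism if there is a signed graph $G'$ switching equivalent to $G$ such that for every edge $uv$ of $G'$, $\varphi(u)\varphi(v)$ is an edge of $H$ with the same sign as $uv$ in $G'$. The chromatic number $\chi_s(G)$ is the minimum order of a signed graph $H$ such that $G$ admits a homomorphism to $H$; for a class $\mathcal{C}$ of signed graphs, $\chi_s(\mathcal{C})$ is the maximum of $\chi_s(G)$ over $G\in\mathcal{C}$. The maximum average degree $\mathrm{mad}(G)$ is the maximum of $2|E(H)|/|V(H)|$ over all (nonempty) subgraphs $H$ of the underlying graph; $\mathcal{M}_k$ denotes the class of signed graphs with $\mathrm{mad} < k$. For a prime power $q\equiv 1 \pmod 4$, the signed Paley graph $SP_q$ has vertex set the finite field $\mathbb{F}_q$, and any two distinct vertices $u,v$ are joined by a positive edge if $u-v$ is a square in $\mathbb{F}_q$ and by a negative edge otherwise. For a signed graph $H$, $H^+$ denotes the signed graph obtained from $H$ by adding one new vertex joined by a positive edge to every vertex of $H$. Thus $SP_9^+$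 is a complete signed graph on $10$ vertices. *)

theory Defs
  imports Complex_Main
begin

definition signed_graph :: "'a set \<Rightarrow> 'a set set \<Rightarrow> ('a set \<Rightarrow> int) \<Rightarrow> bool" where
  "signed_graph V E s \<longleftrightarrow> finite V \<and>
     E \<subseteq> {{u, v} | u v. u \<in> V \<and> v \<in> V \<and> u \<noteq> v} \<and>
     (\<forall>e\<in>E. s e = 1 \<or> s e = -1)"

definition switch :: "'a \<Rightarrow> ('a set \<Rightarrow> int) \<Rightarrow> ('a set \<Rightarrow> int)" where
  "switch v s = (\<lambda>e. if v \<in> e then - s e else s e)"

inductive switch_equiv :: "'a set \<Rightarrow> ('a set \<Rightarrow> int) \<Rightarrow> ('a set \<Rightarrow> int) \<Rightarrow> bool"
  for V :: "'a set" where
  refl: "switch_equiv V s s"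
| step: "switch_equiv V s s' \<Longrightarrow> v \<in> V \<Longrightarrow> switch_equiv V s (switch v s')"

definition signed_hom ::
  "'a set \<Rightarrow> 'a set set \<Rightarrow> ('a set \<Rightarrow> int) \<Rightarrow>
   'b set \<Rightarrow> 'b set set \<Rightarrow> ('b set \<Rightarrow> int) \<Rightarrow> ('a \<Rightarrow> 'b) \<Rightarrow> bool" where
  "signed_hom V E s VH EH sH \<phi> \<longleftrightarrow>
     \<phi> ` V \<subseteq> VH \<and>
     (\<exists>s'. switch_equiv V s s' \<and>
        (\<forall>u v. {u, v} \<in> E \<longrightarrow> {\<phi> u, \<phi> v} \<in> EH \<and> sH {\<phi> u, \<phi> v} = s' {u, v}))"

definition mad :: "'a set \<Rightarrow> 'a set set \<Rightarrow> real" where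
  "mad V E = Max {2 * real (card F) / real (card W) | W F.
       W \<subseteq> V \<and> W \<noteq> {} \<and> F \<subseteq> E \<and> (\<forall>e\<in>F. e \<subseteq> W)}"

text \<open>F_9 is realised as F_3[i] with i^2 = -1 (x^2+1 is irreducible over F_3):
elements are pairs (a,b) with a,b in {0,1,2}, representing a + b i.\<close>

definition F9 :: "(int \<times> int) set" where
  "F9 = {0..2} \<times> {0..2}"

definition f9_sub :: "int \<times> int \<Rightarrow> int \<times> int \<Rightarrow> int \<times> int" where
  "f9_sub x y = ((fst x - fst y) mod 3, (snd x - snd y) mod 3)"

definition f9_mult :: "int \<times> int \<Rightarrow> int \<times> int \<Rightarrow> int \<times> int" where
  "f9_mult x y = ((fst x * fst y - snd x * snd y) mod 3, (fst x * snd y + snd x * fst y) mod 3)"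

definition f9_square :: "int \<times> int \<Rightarrow> bool" where
  "f9_square x \<longleftrightarrow> (\<exists>w\<in>F9. f9_mult w w = x)"

definition SP9p_V :: "(int \<times> int) option set" where
  "SP9p_V = insert None (Some ` F9)"

definition SP9p_E :: "(int \<times> int) option set set" where
  "SP9p_E = {{u, v} | u v. u \<in> SP9p_V \<and> v \<in> SP9p_V \<and> u \<noteq> v}"

definition SP9p_s :: "(int \<times> int) option set \<Rightarrow> int" where
  "SP9p_s e = (if None \<in> e then 1
     else if (\<exists>u v. e = {Some u, Some v} \<and> f9_square (f9_sub u v)) then 1 else -1)"

end

theory Submission
  imports Defs
begin

text \<open>
  A homomorphism to $SP_9^+$ up to switching is the same as a sign-preserving homomorphism to its
  double cover, whose $20$ vertices (``colours'') are pairs of a vertex of $SP_9^+$ and a sign. Since the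
  Seidel matrix of $SP_9^+$ satisfies $S^2 = 9I$, a colour has $9$ positive neighbours, two
  non-opposite colours have at least $4$ common ones, and three pairwise non-opposite colours
  have at least one. Hence a vertex $t$ of degree at most $3$ can be coloured
  last unless two of its neighbours are seen from $t$ as opposite colours, so that $t$ forbids at most
  $\deg t - 1$ colours at each neighbour.

  In a minimal counterexample the small vertices (degree at most $3$) are independent, and a vertex
  with $k \le 2$ big neighbours must have weight $n_2 + 2 n_3$ at least $20$, $9$, $4$ for $k = 0, 1, 2$, where
  $n_i$ counts its neighbours of degree $i$. Two kinds of vertices would
  still lack charge in the discharging: degree $4$ with $n_2 = 1$, $k = 3$, and degree $6$ with $n_2 = 4$, $k = 2$.
  Such a bad vertex forbids at most $3$ colours at a big neighbour that is coloured before it;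
  this bounds how bad vertices can cluster. With initial charges $30 \deg v - 102$, every big
  vertex gives $21$ to each neighbour of degree $2$ and $4$ to each of degree $3$, and every big vertex that
  is not bad gives $3$ to each bad neighbour; all final charges are nonnegative, so the
  average degree is at least $17/5$.
\<close>

section \<open>Colours\<close>

datatype f3 = F0 | F1 | F2

type_synonym pt = "(f3 \<times> f3) option"
type_synonym col = "pt \<times> bool"

lemma UNIV_f3: "UNIV = {F0, F1, F2}"
  using f3.exhaust by auto

instance f3 :: finite
  by standard (simp add: UNIV_f3)

text \<open>The Seidel matrix of $SP_9^+$, with \<open>None\<close> the added vertex. The nonzero squares of $F_9 = F_3[i]$ are $1, 2, i, 2i$,
  so two distinct field elements differ by a square iff they agree in exactly one coordinate.\<close>

fun seidel :: "pt \<Rightarrow> pt \<Rightarrow> int" where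
  "seidel None None = 0"
| "seidel None (Some _) = 1"
| "seidel (Some _) None = 1"
| "seidel (Some (a, b)) (Some (c, d)) =
     (if a = c \<and> b = d then 0 else if a = c \<or> b = d then 1 else -1)"

lemma UNIV_pt: "(UNIV :: pt set) =
  {None, Some (F0, F0), Some (F0, F1), Some (F0, F2), Some (F1, F0), Some (F1, F1), Some (F1, F2),
   Some (F2, F0), Some (F2, F1), Some (F2, F2)}"
  by (auto simp: UNIV_option_conv UNIV_f3 simp flip: UNIV_Times_UNIV)

lemma card_pt: "card (UNIV :: pt set) = 10"
  by (simp add: UNIV_pt)

lemma seidel_sym: "seidel x y = seidel y x"
  by (cases "(x, y)" rule: seidel.cases) auto

lemma seidel_self [simp]: "seidel x x = 0"
  by (cases x) auto

lemma seidel_cases: "x \<noteq> y \<Longrightarrow> seidel x y = 1 \<or> seidel x y = -1"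
  by (cases "(x, y)" rule: seidel.cases) auto

text \<open>The off-diagonal part of S^2 = 9I: \<open>seidel\<close> is a symmetric conference
  matrix of order 10. All pairs of columns are evaluated.\<close>

lemma seidel_orth:
  assumes "x \<noteq> y" shows "(\<Sum>t\<in>UNIV. seidel t x * seidel t y) = 0"
proof -
  have "\<forall>x\<in>UNIV. \<forall>y\<in>UNIV. x \<noteq> y \<longrightarrow> (\<Sum>t\<in>UNIV. seidel t x * seidel t y) = 0"
    unfolding UNIV_pt by simp
  then show ?thesis using assms by blast
qed

section \<open>The double cover and its common neighbourhoods\<close>

definition sg :: "bool \<Rightarrow> int" where "sg b = (if b then 1 else -1)"

lemma sg_mult_self [simp]: "sg b * sg b = 1" "sg b * (sg b * x) = x"
  by (auto simp: sg_def)

definition neg :: "col \<Rightarrow> col" where "neg p = (fst p, \<not> snd p)"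
definition act :: "bool \<Rightarrow> col \<Rightarrow> col" where "act b p = (if b then p else neg p)"
text \<open>The positive neighbourhood in the double cover; \<open>snd\<close> tells whether the
  vertex is taken as it stands or switched. As the diagonal of \<open>seidel\<close> is 0, neither
  \<open>p\<close> nor \<open>neg p\<close> lies in \<open>Npos p\<close>.\<close>

definition Npos :: "col \<Rightarrow> col set" where
  "Npos p = {q. seidel (fst p) (fst q) = sg (snd p) * sg (snd q)}"

lemma neg_neg [simp]: "neg (neg p) = p" by (simp add: neg_def)
lemma fst_neg [simp]: "fst (neg p) = fst p" by (simp add: neg_def)
lemma neg_eq_iff [simp]: "neg p = neg q \<longleftrightarrow> p = q" by (auto simp: neg_def prod_eq_iff)
lemma neg_neq [simp]: "neg p \<noteq> p" "p \<noteq> neg p" by (auto simp: neg_def prod_eq_iff)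
lemma act_act [simp]: "act b (act b p) = p" by (simp add: act_def)
lemma fst_act [simp]: "fst (act b p) = fst p" by (simp add: act_def)
lemma act_eq_iff [simp]: "act b p = act b q \<longleftrightarrow> p = q" by (simp add: act_def)
lemma inj_act: "inj_on (act b) A" by (auto intro: inj_onI)

lemma in_Npos_sym: "q \<in> Npos p \<longleftrightarrow> p \<in> Npos q"
  by (simp add: Npos_def seidel_sym mult.commute)

lemma in_Npos_neg: "q \<in> Npos (neg p) \<longleftrightarrow> neg q \<in> Npos p"
  by (auto simp: Npos_def neg_def sg_def)

lemma in_Npos_act: "q \<in> Npos (act b p) \<longleftrightarrow> act b q \<in> Npos p"
  by (auto simp: act_def in_Npos_neg)

lemma Npos_neg_disjoint: "q \<in> Npos p \<Longrightarrow> q \<notin> Npos (neg p)"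
  by (auto simp: Npos_def neg_def sg_def split: if_splits)

lemma in_Npos_fst_neq: "q \<in> Npos p \<Longrightarrow> fst q \<noteq> fst p"
  by (auto simp: Npos_def sg_def split: if_splits)

lemma fst_eq_cases: "fst p = fst q \<Longrightarrow> p = q \<or> p = neg q"
  by (auto simp: neg_def prod_eq_iff)

lemma card_col: "card (UNIV :: col set) = 20"
  by (simp add: card_pt flip: UNIV_Times_UNIV)

lemma inj_fst_Npos: "inj_on fst (Npos p)"
  by (auto simp: inj_on_def Npos_def sg_def prod_eq_iff split: if_splits)

text \<open>Over each of the nine vertices other than \<open>fst p\<close>, exactly one of the two
  opposite colours is a positive neighbour.\<close>

lemma card_Npos: "card (Npos p) = 9"
proof -
  have "fst ` Npos p = UNIV - {fst p}"
  proof
    show "UNIV - {fst p} \<subseteq> fst ` Npos p"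
    proof
      fix y assume "y \<in> UNIV - {fst p}"
      then have "(y, True) \<in> Npos p \<or> (y, False) \<in> Npos p"
        using seidel_cases[of "fst p" y] by (auto simp: Npos_def sg_def)
      then show "y \<in> fst ` Npos p" by force
    qed
  qed (auto dest: in_Npos_fst_neq)
  then have "card (Npos p) = card (UNIV - {fst p})"
    using card_image[OF inj_fst_Npos] by metis
  then show ?thesis by (simp add: card_Diff_singleton card_pt)
qed

lemma int_card_sum: "finite A \<Longrightarrow> int (card {x\<in>A. P x}) = (\<Sum>x\<in>A. if P x then 1 else 0)"
  by (simp add: sum.If_cases Int_def)

text \<open>A vertex \<open>t\<close> carries a common neighbour iff the signs towards it agree,
  that is \<open>h t = 1\<close>. By orthogonality the eight values of \<open>h\<close> sum to 0, so
  half of them are 1.\<close>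

lemma card_Npos2:
  assumes "fst a \<noteq> fst b" shows "card (Npos a \<inter> Npos b) = 4"
proof -
  define h where "h t = sg (snd a) * sg (snd b) * (seidel t (fst a) * seidel t (fst b))" for t
  let ?A = "UNIV - {fst a, fst b}"
  have im: "fst ` (Npos a \<inter> Npos b) = {t \<in> ?A. h t = 1}"
  proof (intro equalityI subsetI)
    fix t assume "t \<in> {t \<in> ?A. h t = 1}"
    then have t: "t \<noteq> fst a" "t \<noteq> fst b" "h t = 1" by auto
    then have "(t, True) \<in> Npos a \<inter> Npos b \<or> (t, False) \<in> Npos a \<inter> Npos b"
      using seidel_cases[of t "fst a"] seidel_cases[of t "fst b"]
      by (auto simp: Npos_def h_def sg_def seidel_sym[of _ t] split: if_splits)
    then show "t \<in> fst ` (Npos a \<inter> Npos b)" by force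
  next
    fix t assume "t \<in> fst ` (Npos a \<inter> Npos b)"
    then obtain q where q: "q \<in> Npos a" "q \<in> Npos b" "t = fst q" by auto
    then show "t \<in> {t \<in> ?A. h t = 1}" using in_Npos_fst_neq[OF q(1)] in_Npos_fst_neq[OF q(2)]
      by (auto simp: Npos_def h_def sg_def seidel_sym[of _ "fst q"] split: if_splits)
  qed
  have "card (Npos a \<inter> Npos b) = card (fst ` (Npos a \<inter> Npos b))"
    by (rule card_image[symmetric]) (meson inf_le1 inj_fst_Npos inj_on_subset)
  then have "2 * int (card (Npos a \<inter> Npos b)) = (\<Sum>t\<in>?A. 2 * (if h t = 1 then 1 else 0))"
    by (simp only: im int_card_sum[OF finite] sum_distrib_left)
  also have "\<dots> = (\<Sum>t\<in>?A. 1 + h t)"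
  proof (rule sum.cong)
    fix t assume "t \<in> ?A"
    then have "seidel t (fst a) = 1 \<or> seidel t (fst a) = -1" "seidel t (fst b) = 1 \<or> seidel t (fst b) = -1"
      using seidel_cases by auto
    then show "2 * (if h t = 1 then 1 else 0) = 1 + h t"
      by (elim disjE) (simp_all add: h_def sg_def)
  qed simp
  also have "\<dots> = int (card ?A) + (\<Sum>t\<in>?A. h t)" by (simp add: sum.distrib)
  also have "(\<Sum>t\<in>?A. h t) = (\<Sum>t\<in>UNIV. h t)"
    by (rule sum.mono_neutral_left) (auto simp: h_def)
  also have "\<dots> = 0" by (simp add: h_def seidel_orth[OF assms] flip: sum_distrib_left)
  also have "int (card ?A) = 8" using assms by (simp add: card_Diff_subset card_pt)
  finally show ?thesis by simp
qed

definition col_sign :: "col \<Rightarrow> col \<Rightarrow> int" where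
  "col_sign p q = sg (snd p) * sg (snd q) * seidel (fst p) (fst q)"

text \<open>For three signs, 1 plus the sum of their pairwise products is 4 if all agree and 0
  otherwise. Summed over the seven remaining vertices, this makes 4 times the count equal to 7 minus
  the sum of the pairwise products of the three \<open>col_sign\<close> values, which is 3 or
  -1.\<close>

lemma card_Npos3:
  assumes d: "fst a \<noteq> fst b" "fst b \<noteq> fst c" "fst a \<noteq> fst c"
  shows "card (Npos a \<inter> Npos b \<inter> Npos c) = (if col_sign a b = col_sign b c \<and> col_sign b c = col_sign a c then 1 else 2)"
proof -
  define g where "g p t = sg (snd p) * seidel t (fst p)" for p t
  define h where "h t = g a t * g b t + g b t * g c t + g a t * g c t" for t
  let ?A = "UNIV - {fst a, fst b, fst c}"
  have gc: "g p t = 1 \<or> g p t = -1" if "t \<noteq> fst p" for p t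
    using seidel_cases[OF that] by (auto simp: g_def sg_def)
  have gN: "q \<in> Npos p \<longleftrightarrow> g p (fst q) = sg (snd q)" for p q
    by (auto simp: Npos_def g_def seidel_sym[of _ "fst q"] sg_def)
  have im: "fst ` (Npos a \<inter> Npos b \<inter> Npos c) = {t \<in> ?A. g a t = g b t \<and> g b t = g c t}"
  proof (intro equalityI subsetI)
    fix t assume "t \<in> {t \<in> ?A. g a t = g b t \<and> g b t = g c t}"
    then have t: "t \<noteq> fst a" "g a t = g b t" "g b t = g c t" by auto
    then have "(t, True) \<in> Npos a \<inter> Npos b \<inter> Npos c \<or> (t, False) \<in> Npos a \<inter> Npos b \<inter> Npos c"
      using gc[of t a] by (auto simp: gN sg_def)
    then show "t \<in> fst ` (Npos a \<inter> Npos b \<inter> Npos c)" by force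
  next
    fix t assume "t \<in> fst ` (Npos a \<inter> Npos b \<inter> Npos c)"
    then obtain q where q: "q \<in> Npos a" "q \<in> Npos b" "q \<in> Npos c" "t = fst q" by auto
    then show "t \<in> {t \<in> ?A. g a t = g b t \<and> g b t = g c t}"
      using in_Npos_fst_neq[OF q(1)] in_Npos_fst_neq[OF q(2)] in_Npos_fst_neq[OF q(3)] by (auto simp: gN)
  qed
  \<comment> \<open>The sum over all vertices is 0, and the diagonal kills its terms at
    \<open>fst p\<close> and \<open>fst q\<close>; only the term at \<open>fst r\<close> remains to
    be compensated.\<close>
  have orth: "(\<Sum>t\<in>?A. g p t * g q t) = - (g p (fst r) * g q (fst r))"
    if "fst p \<noteq> fst q" "fst p \<noteq> fst r" "fst q \<noteq> fst r"
      "{fst p, fst q, fst r} = {fst a, fst b, fst c}" for p q r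
  proof -
    have "(\<Sum>t\<in>UNIV. g p t * g q t) = (\<Sum>t\<in>UNIV. sg (snd p) * sg (snd q) * (seidel t (fst p) * seidel t (fst q)))"
      by (simp add: g_def algebra_simps)
    also have "\<dots> = 0" by (simp only: seidel_orth[OF that(1)] mult_zero_right flip: sum_distrib_left)
    finally have "0 = (\<Sum>t\<in>?A. g p t * g q t) + (\<Sum>t\<in>{fst p, fst q, fst r}. g p t * g q t)"
      unfolding that(4) by (subst (asm) sum.subset_diff[of "{fst a, fst b, fst c}"]) auto
    then show ?thesis using that(1-3) by (simp add: g_def)
  qed
  have "card (Npos a \<inter> Npos b \<inter> Npos c) = card (fst ` (Npos a \<inter> Npos b \<inter> Npos c))"
    by (rule card_image[symmetric]) (meson inf_le1 inj_fst_Npos inj_on_subset)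
  then have "4 * int (card (Npos a \<inter> Npos b \<inter> Npos c)) = (\<Sum>t\<in>?A. 4 * (if g a t = g b t \<and> g b t = g c t then 1 else 0))"
    by (simp only: im int_card_sum[OF finite] sum_distrib_left)
  also have "\<dots> = (\<Sum>t\<in>?A. 1 + h t)"
  proof (rule sum.cong)
    fix t assume "t \<in> ?A"
    then have "g a t = 1 \<or> g a t = -1" "g b t = 1 \<or> g b t = -1" "g c t = 1 \<or> g c t = -1"
      using gc by auto
    then show "4 * (if g a t = g b t \<and> g b t = g c t then 1 else 0) = 1 + h t"
      by (elim disjE) (simp_all add: h_def)
  qed simp
  also have "\<dots> = int (card ?A) + (\<Sum>t\<in>?A. h t)" by (simp add: sum.distrib)
  also have "int (card ?A) = 7" using d by (simp add: card_Diff_subset card_pt)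
  also have "(\<Sum>t\<in>?A. h t) = - (g a (fst c) * g b (fst c)) - g b (fst a) * g c (fst a) - g a (fst b) * g c (fst b)"
    unfolding h_def sum.distrib using d
    by (subst orth[of a b c], simp_all, subst orth[of b c a], simp_all add: insert_commute,
        subst orth[of a c b], simp_all add: insert_commute)
  finally have *: "4 * int (card (Npos a \<inter> Npos b \<inter> Npos c)) =
      7 - (g a (fst c) * g b (fst c)) - g b (fst a) * g c (fst a) - g a (fst b) * g c (fst b)" by simp
  have **: "g a (fst c) * g b (fst c) = col_sign a c * col_sign b c" "g b (fst a) * g c (fst a) = col_sign a b * col_sign a c"
    "g a (fst b) * g c (fst b) = col_sign a b * col_sign b c"
    by (auto simp: g_def col_sign_def seidel_sym algebra_simps)
  have "col_sign p q = 1 \<or> col_sign p q = -1" if "fst p \<noteq> fst q" for p q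
    using seidel_cases[OF that] by (auto simp: col_sign_def sg_def)
  then have "col_sign a b = 1 \<or> col_sign a b = -1" "col_sign b c = 1 \<or> col_sign b c = -1" "col_sign a c = 1 \<or> col_sign a c = -1"
    using d by auto
  then show ?thesis using * unfolding ** by (elim disjE) simp_all
qed

lemma col_sign_Npos: "q \<in> Npos p \<longleftrightarrow> col_sign p q = 1"
  by (auto simp: col_sign_def Npos_def sg_def)

lemma col_sign_cases: "fst p \<noteq> fst q \<Longrightarrow> col_sign p q = 1 \<or> col_sign p q = -1"
  using seidel_cases[of "fst p" "fst q"] by (auto simp: col_sign_def sg_def)

lemma card_Npos2_ge: "a \<noteq> neg b \<Longrightarrow> 4 \<le> card (Npos a \<inter> Npos b)"
  using fst_eq_cases[of a b] card_Npos2[of a b] card_Npos[of a] by (cases "fst a = fst b") auto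

text \<open>This is what lets a vertex of degree at most 3 be coloured last. Two of the colours over
  the same vertex coincide, not being opposite, and then the bound for two colours applies.\<close>

lemma Npos3_nonempty:
  assumes "a \<noteq> neg b" "b \<noteq> neg c" "a \<noteq> neg c" shows "Npos a \<inter> Npos b \<inter> Npos c \<noteq> {}"
proof (cases "fst a \<noteq> fst b \<and> fst b \<noteq> fst c \<and> fst a \<noteq> fst c")
  case True
  then have "card (Npos a \<inter> Npos b \<inter> Npos c) \<noteq> 0" using card_Npos3[of a b c] by (auto split: if_splits)
  then show ?thesis by (metis card.empty)
next
  case False
  then have "a = b \<or> b = c \<or> a = c" using assms fst_eq_cases by blast
  then show ?thesis using card_Npos2_ge[OF assms(1)] card_Npos2_ge[OF assms(2)] card_Npos2_ge[OF assms(3)]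
    by (auto simp: Int_ac)
qed

text \<open>Distinct colours over the same vertex are opposite and have no common positive
  neighbour.\<close>

lemma card_Npos3_le:
  assumes "a \<noteq> b" "b \<noteq> c" "a \<noteq> c" shows "card (Npos a \<inter> Npos b \<inter> Npos c) \<le> 2"
proof (cases "fst a \<noteq> fst b \<and> fst b \<noteq> fst c \<and> fst a \<noteq> fst c")
  case True
  then show ?thesis using card_Npos3[of a b c] by auto
next
  case False
  then have "a = neg b \<or> b = neg c \<or> a = neg c" using assms fst_eq_cases by blast
  then have "Npos a \<inter> Npos b \<inter> Npos c = {}" using Npos_neg_disjoint by blast
  then show ?thesis by simp
qed

lemma col_sign_neg [simp]: "col_sign (neg p) q = - col_sign p q" "col_sign p (neg q) = - col_sign p q"
  by (auto simp: col_sign_def neg_def sg_def)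

lemma col_sign_sym: "col_sign p q = col_sign q p"
  by (simp add: col_sign_def seidel_sym algebra_simps)

section \<open>Counting colours that leave a later vertex without a choice\<close>

lemma card_le_1_eqI: "finite A \<Longrightarrow> card A \<le> 1 \<Longrightarrow> x \<in> A \<Longrightarrow> y \<in> A \<Longrightarrow> x = y"
  by (auto simp: card_le_Suc0_iff_eq)

text \<open>Meant for a \<open>bad4\<close> vertex that sees \<open>a\<close>, \<open>b\<close>,
  \<open>q\<close> at its big neighbours, with \<open>R\<close> forbidden by its neighbour of degree
  2. Apart from \<open>neg a\<close> and \<open>neg b\<close>, a blocking \<open>q\<close> has
  exactly one common neighbour \<open>e\<close> with \<open>a\<close> and \<open>b\<close>, and it
  is the element of \<open>R\<close>. By \<open>card_Npos3\<close> the three signs then agree, which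
  determines \<open>q\<close>.\<close>

lemma card_blocked_by_two:
  assumes ab: "a \<noteq> neg b" and R: "card R \<le> 1"
  shows "card {q. Npos q \<inter> (Npos a \<inter> Npos b) \<subseteq> R} \<le> 3"
proof (cases "fst a = fst b")
  case True
  then have "a = b" using ab fst_eq_cases by blast
  have "q = neg a" if "Npos q \<inter> (Npos a \<inter> Npos b) \<subseteq> R" for q
  proof (rule ccontr)
    assume "q \<noteq> neg a"
    then have "4 \<le> card (Npos q \<inter> Npos a)" by (rule card_Npos2_ge)
    also have "\<dots> \<le> card R" using that \<open>a = b\<close> by (intro card_mono) auto
    finally show False using R by simp
  qed
  then have "{q. Npos q \<inter> (Npos a \<inter> Npos b) \<subseteq> R} \<subseteq> {neg a}" by auto
  then show ?thesis using card_mono[of "{neg a}" "{q. Npos q \<inter> (Npos a \<inter> Npos b) \<subseteq> R}"] by simp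
next
  case False
  define Q where "Q = {q. q \<noteq> neg a \<and> q \<noteq> neg b \<and> Npos q \<inter> (Npos a \<inter> Npos b) \<subseteq> R}"
  have Q: "fst q \<noteq> fst a \<and> fst q \<noteq> fst b \<and> col_sign a b = col_sign b q \<and> col_sign b q = col_sign a q
      \<and> (\<exists>e\<in>R. e \<in> Npos q \<and> e \<in> Npos a \<and> e \<in> Npos b)" if "q \<in> Q" for q
  proof -
    have q: "q \<noteq> neg a" "q \<noteq> neg b" "Npos q \<inter> (Npos a \<inter> Npos b) \<subseteq> R" using that by (auto simp: Q_def)
    have "card (Npos a \<inter> Npos b \<inter> Npos q) \<le> card R" using q(3) by (intro card_mono) auto
    then have le: "card (Npos a \<inter> Npos b \<inter> Npos q) \<le> 1" using R by simp
    have ne: "fst q \<noteq> fst a" "fst q \<noteq> fst b"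
      using fst_eq_cases[of q a] fst_eq_cases[of q b] q le card_Npos2[OF False]
      by (auto simp: Int_commute Int_left_commute)
    have "col_sign a b = col_sign b q \<and> col_sign b q = col_sign a q" using card_Npos3[of a b q] ne False le
      by (auto split: if_splits)
    moreover have "Npos a \<inter> Npos b \<inter> Npos q \<noteq> {}"
      using q by (intro Npos3_nonempty ab) (metis neg_neg)+
    ultimately show ?thesis using ne q(3) by blast
  qed
  have "q = q'" if qQ: "q \<in> Q" "q' \<in> Q" for q q'
  proof -
    obtain e where e: "e \<in> R" "e \<in> Npos q" "e \<in> Npos a" "e \<in> Npos b" using Q[OF qQ(1)] by blast
    obtain e' where e': "e' \<in> R" "e' \<in> Npos q'" "e' \<in> Npos a" "e' \<in> Npos b" using Q[OF qQ(2)] by blast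
    have "e' = e" using card_le_1_eqI[OF finite R] e e' by blast
    note e' = e'[unfolded this]
    have fe: "fst e \<noteq> fst a" "fst e \<noteq> fst b" using e in_Npos_fst_neq by blast+
    \<comment> \<open>With sign 1, \<open>q\<close> is the unique common neighbour of
      \<open>a\<close>, \<open>b\<close>, \<open>e\<close>; with sign -1, \<open>neg q\<close> is
      that of \<open>a\<close>, \<open>b\<close>, \<open>neg e\<close>.\<close>
    consider "col_sign a b = 1" | "col_sign a b = -1" using col_sign_cases[OF False] by blast
    then show ?thesis
    proof cases
      case 1
      then have "card (Npos a \<inter> Npos b \<inter> Npos e) = 1"
        using card_Npos3[of a b e] e fe False by (auto simp: col_sign_Npos)
      moreover have "q \<in> Npos a \<inter> Npos b \<inter> Npos e" "q' \<in> Npos a \<inter> Npos b \<inter> Npos e"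
        using Q[OF qQ(1)] Q[OF qQ(2)] e e' 1 by (auto simp: col_sign_Npos col_sign_sym)
      ultimately show ?thesis using card_le_1_eqI[of "Npos a \<inter> Npos b \<inter> Npos e"] by auto
    next
      case 2
      then have "card (Npos a \<inter> Npos b \<inter> Npos (neg e)) = 1"
        using card_Npos3[of a b "neg e"] e fe False by (auto simp: col_sign_Npos)
      moreover have "neg q \<in> Npos a \<inter> Npos b \<inter> Npos (neg e)" "neg q' \<in> Npos a \<inter> Npos b \<inter> Npos (neg e)"
        using Q[OF qQ(1)] Q[OF qQ(2)] e e' 2 by (auto simp: col_sign_Npos col_sign_sym)
      ultimately have "neg q = neg q'" using card_le_1_eqI[of "Npos a \<inter> Npos b \<inter> Npos (neg e)" "neg q" "neg q'"] by auto
      then show ?thesis by simp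
    qed
  qed
  then have "card Q \<le> 1" by (auto simp: card_le_Suc0_iff_eq)
  moreover have "card {q. Npos q \<inter> (Npos a \<inter> Npos b) \<subseteq> R} \<le> card ({neg a, neg b} \<union> Q)"
    by (rule card_mono) (auto simp: Q_def)
  moreover have "card ({neg a, neg b} \<union> Q) \<le> card {neg a, neg b} + card Q" by (rule card_Un_le)
  moreover have "card {neg a, neg b} \<le> 2" by (simp add: card_insert_if)
  ultimately show ?thesis by linarith
qed

text \<open>Meant for a \<open>bad6\<close> vertex that sees \<open>q\<close> and \<open>a\<close>
  at its big neighbours. Apart from \<open>neg a\<close>, such a \<open>q\<close> has only four
  common neighbours with \<open>a\<close>, and they include \<open>R\<close>, which has at least
  three elements. Two such \<open>q\<close> would contradict \<open>card_Npos3_le\<close>. With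
  \<open>m = 0\<close> no choice is left, with \<open>m = 1\<close> at most one.\<close>

lemma card_blocked_by_one:
  assumes "card R + m \<le> 4" "m \<le> 1"
  shows "card {q. card (Npos q \<inter> Npos a - R) \<le> m} \<le> 2"
proof -
  define Q where "Q = {q. q \<noteq> neg a \<and> card (Npos q \<inter> Npos a - R) \<le> m}"
  have Q: "fst q \<noteq> fst a \<and> R \<subseteq> Npos q \<inter> Npos a \<and> 3 \<le> card R" if "q \<in> Q" for q
  proof -
    have q: "q \<noteq> neg a" "card (Npos q \<inter> Npos a - R) \<le> m" using that by (auto simp: Q_def)
    have split: "card (Npos q \<inter> Npos a) = card (Npos q \<inter> Npos a \<inter> R) + card (Npos q \<inter> Npos a - R)"
      using card_Int_Diff[of "Npos q \<inter> Npos a" R] by simp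
    have le: "card (Npos q \<inter> Npos a \<inter> R) \<le> card R" by (rule card_mono) auto
    have "4 \<le> card (Npos q \<inter> Npos a)" by (rule card_Npos2_ge[OF q(1)])
    then have eq: "card (Npos q \<inter> Npos a \<inter> R) = card R" "card R + m = 4" "card (Npos q \<inter> Npos a) = 4"
      using assms split le q(2) by linarith+
    then have "Npos q \<inter> Npos a \<inter> R = R" using card_subset_eq[of R] by auto
    moreover have "fst q \<noteq> fst a" using fst_eq_cases[of q a] q(1) eq(3) card_Npos[of a] by auto
    ultimately show ?thesis using eq assms by auto
  qed
  have "q = q'" if "q \<in> Q" "q' \<in> Q" for q q'
  proof (rule ccontr)
    assume "q \<noteq> q'"
    have "R \<subseteq> Npos q \<inter> Npos q' \<inter> Npos a" using Q that by blast
    then have "card R \<le> card (Npos q \<inter> Npos q' \<inter> Npos a)" by (intro card_mono) auto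
    also have "\<dots> \<le> 2" by (rule card_Npos3_le) (use \<open>q \<noteq> q'\<close> Q[OF that(1)] Q[OF that(2)] in auto)
    finally show False using Q[OF that(1)] by simp
  qed
  then have "card Q \<le> 1" by (auto simp: card_le_Suc0_iff_eq)
  moreover have "card {q. card (Npos q \<inter> Npos a - R) \<le> m} \<le> card (insert (neg a) Q)"
    by (rule card_mono) (auto simp: Q_def)
  moreover have "card (insert (neg a) Q) \<le> Suc (card Q)" by (simp add: card_insert_if)
  ultimately show ?thesis by linarith
qed

lemma card_le_3_cases:
  assumes "finite P" "card P \<le> 3" "P \<noteq> {}" shows "\<exists>a b c. P = {a, b, c}"
proof -
  have "card P = 1 \<or> card P = 2 \<or> card P = 3" using assms card_gt_0_iff[of P] by linarith
  then consider x where "P = {x}" | x y where "P = {x, y}" | x y z where "P = {x, y, z}"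
    unfolding One_nat_def card_1_singleton_iff card_2_iff card_3_iff by blast
  then show ?thesis by cases (metis insert_absorb2)+
qed

lemma ex_common_Npos:
  assumes "finite P" "card P \<le> 3" and nc: "\<And>p q. p \<in> P \<Longrightarrow> q \<in> P \<Longrightarrow> p \<noteq> neg q"
  shows "\<exists>r. \<forall>p\<in>P. r \<in> Npos p"
proof (cases "P = {}")
  case False
  then obtain a b c where P: "P = {a, b, c}" using card_le_3_cases assms by metis
  then have "Npos a \<inter> Npos b \<inter> Npos c \<noteq> {}" by (intro Npos3_nonempty nc) auto
  then show ?thesis using P by auto
qed auto

text \<open>Colours guaranteed by \<open>k\<close> coloured neighbours without conflict; it is
  consulted only for \<open>k\<close> at most 2, so the last value stands for
  \<open>k = 2\<close>.\<close>

definition avail :: "nat \<Rightarrow> nat" where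
  "avail k = (if k = 0 then 20 else if k = 1 then 9 else 4)"

lemma avail_le_card:
  assumes "finite K" "card K \<le> 2"
    and nc: "\<And>v w. v \<in> K \<Longrightarrow> w \<in> K \<Longrightarrow> f v \<noteq> neg (f w)"
  shows "avail (card K) \<le> card {r. \<forall>w\<in>K. r \<in> Npos (f w)}"
proof -
  have "card K = 0 \<or> card K = 1 \<or> card K = 2" using assms by linarith
  then consider "K = {}" | w where "K = {w}" | v w where "v \<noteq> w" "K = {v, w}"
    using assms by (auto simp: card_1_singleton_iff card_2_iff)
  then show ?thesis
  proof cases
    case 1 then show ?thesis by (simp add: avail_def card_col)
  next
    case 2 then show ?thesis by (simp add: avail_def card_Npos)
  next
    case (3 v w)
    then have "4 \<le> card (Npos (f v) \<inter> Npos (f w))" by (intro card_Npos2_ge nc) auto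
    then show ?thesis using 3 by (simp add: avail_def Int_def)
  qed
qed

lemma exists_avoiding:
  fixes A :: "col set" shows "card B < card A \<Longrightarrow> \<exists>r\<in>A. r \<notin> B"
  using card_mono[of B A] by (metis finite not_less subsetI)

text \<open>\<open>act b\<close> is an involution, so counts of colours agree at both ends of a
  signed edge.\<close>

lemma card_act_Collect: "card {q. P (act b q)} = card {q. P q}"
proof -
  have "act b ` {q. P (act b q)} = {q. P q}"
  proof (intro equalityI subsetI)
    fix q assume "q \<in> {q. P q}"
    then show "q \<in> act b ` {q. P (act b q)}" by (intro image_eqI[of _ _ "act b q"]) auto
  qed auto
  then show ?thesis using card_image[OF inj_act] by metis
qed

lemma card_Un3_le: "card (A \<union> B \<union> C) \<le> card A + card B + card C"
  by (meson add_le_mono1 card_Un_le order_trans)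

section \<open>Minimal uncolourable graphs\<close>

definition nb :: "'a set set \<Rightarrow> 'a \<Rightarrow> 'a set" where
  "nb E v = {w. {v, w} \<in> E}"

text \<open>\<open>see \<sigma> c v w\<close> is the colour of \<open>w\<close>, negated if the edge \<open>{v, w}\<close> is negative; the
  signature \<open>\<sigma>\<close> is boolean, with \<open>True\<close> for positive.\<close>

definition see :: "('a set \<Rightarrow> bool) \<Rightarrow> ('a \<Rightarrow> col) \<Rightarrow> 'a \<Rightarrow> 'a \<Rightarrow> col" where
  "see \<sigma> c v w = act (\<sigma> {v, w}) (c w)"

definition valid :: "'a set set \<Rightarrow> ('a set \<Rightarrow> bool) \<Rightarrow> ('a \<Rightarrow> col) \<Rightarrow> bool" where
  "valid E \<sigma> c \<longleftrightarrow> (\<forall>u v. {u, v} \<in> E \<longrightarrow> c v \<in> Npos (see \<sigma> c v u))"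

lemma nb_sym: "w \<in> nb E v \<longleftrightarrow> v \<in> nb E w"
  by (simp add: nb_def insert_commute)

lemma in_Npos_see_sym: "c v \<in> Npos (see \<sigma> c v u) \<longleftrightarrow> c u \<in> Npos (see \<sigma> c u v)"
  unfolding see_def in_Npos_act by (metis in_Npos_act in_Npos_sym insert_commute)

text \<open>The colour of \<open>x\<close> is a positive neighbour of both seen colours, while
  opposite colours have none in common. This information is kept when \<open>x\<close> is later
  uncoloured.\<close>

lemma valid_not_conflicting:
  assumes "valid E \<sigma> c" "{x, v} \<in> E" "{x, w} \<in> E"
  shows "see \<sigma> c x v \<noteq> neg (see \<sigma> c x w)"
proof -
  have "c x \<in> Npos (see \<sigma> c x v)" "c x \<in> Npos (see \<sigma> c x w)"
    using assms by (auto simp: valid_def insert_commute)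
  then show ?thesis using Npos_neg_disjoint by metis
qed

text \<open>A big vertex with two big neighbours keeps charge 9 \<open>n2\<close> + 26
  \<open>n3\<close> - 42 after feeding its small neighbours. The excluded pair belongs to
  \<open>bad6\<close>, where this is -6.\<close>

lemma charge_arith_two:
  fixes n2 n3 :: nat
  assumes "4 \<le> n2 + 2 * n3" "\<not> (n2 = 4 \<and> n3 = 0)"
  shows "42 \<le> 9 * n2 + 26 * n3"
proof (cases n3)
  case 0 then have "5 \<le> n2" using assms by linarith
  then show ?thesis by linarith
qed (use assms in linarith)

text \<open>With three big neighbours, \<open>b\<close> of them bad and fed 3 each, 12 replaces 42.
  The excluded pair belongs to \<open>bad4\<close>.\<close>

lemma charge_arith_three:
  fixes n2 n3 b :: nat
  assumes "1 \<le> n2 + n3" "\<not> (n2 = 1 \<and> n3 = 0)" "b \<le> 3" "n2 + 2 * n3 \<le> 2 \<Longrightarrow> b \<le> 2"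
  shows "12 + 3 * b \<le> 9 * n2 + 26 * n3"
proof (cases n3)
  case 0
  then have "2 \<le> n2" using assms by linarith
  then show ?thesis using assms 0 by (cases "n2 = 2") linarith+
qed (use assms in linarith)

text \<open>Minimality concerns the edges, with the signature fixed. Colourings are total functions,
  so no vertex set is carried along.\<close>

locale minimal_uncolourable =
  fixes E :: "'a set set" and \<sigma> :: "'a set \<Rightarrow> bool"
  assumes finE: "finite E"
    and two: "e \<in> E \<Longrightarrow> card e = 2"
    and uncolourable: "\<not> valid E \<sigma> c"
    and minimal: "E' \<subset> E \<Longrightarrow> \<exists>c. valid E' \<sigma> c"
begin

abbreviation nbs :: "'a \<Rightarrow> 'a set" where "nbs \<equiv> nb E"
abbreviation deg :: "'a \<Rightarrow> nat" where "deg v \<equiv> card (nb E v)"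

lemma irrefl [simp]: "v \<notin> nbs v"
  using two[of "{v, v}"] by (auto simp: nb_def)

lemma finite_nb [simp]: "finite (nbs v)"
proof (rule finite_subset)
  show "nbs v \<subseteq> \<Union>E" by (auto simp: nb_def)
  show "finite (\<Union>E)" using finE two by (metis card.infinite finite_Union zero_neq_numeral)
qed

section \<open>Partial colourings with deferred small vertices\<close>

definition small_indep :: "'a set \<Rightarrow> bool" where
  "small_indep T \<longleftrightarrow> (\<forall>t\<in>T. deg t \<le> 3) \<and> (\<forall>t\<in>T. \<forall>t'\<in>T. t' \<notin> nbs t)"

text \<open>The vertices in \<open>T\<close> are to be coloured last: they only impose that no two of their neighbours in
  \<open>A\<close> are seen as opposite colours.\<close>

definition partial :: "'a set \<Rightarrow> 'a set \<Rightarrow> ('a \<Rightarrow> col) \<Rightarrow> bool" where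
  "partial T A c \<longleftrightarrow> (\<forall>v\<in>A. \<forall>w\<in>A. v \<noteq> w \<longrightarrow>
     (w \<in> nbs v \<longrightarrow> c w \<in> Npos (see \<sigma> c w v)) \<and>
     (\<forall>t\<in>T. v \<in> nbs t \<longrightarrow> w \<in> nbs t \<longrightarrow> see \<sigma> c t v \<noteq> neg (see \<sigma> c t w)))"

text \<open>The solutions for the colour of \<open>v\<close> of a conflict at some \<open>t\<close>
  in \<open>T\<close> with an already coloured \<open>w\<close>; the outer \<open>act\<close>
  carries the colour seen from \<open>t\<close> back to \<open>v\<close>.\<close>

definition forb :: "'a set \<Rightarrow> 'a set \<Rightarrow> ('a \<Rightarrow> col) \<Rightarrow> 'a \<Rightarrow> col set" where
  "forb T A c v = (\<Union>t\<in>nbs v \<inter> T. (\<lambda>w. act (\<sigma> {t, v}) (neg (see \<sigma> c t w))) ` (nbs t \<inter> A - {v}))"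

text \<open>A bound for the size of \<open>forb\<close>: \<open>t\<close> forbids at most one colour
  for each of its neighbours other than \<open>v\<close>.\<close>

definition weight :: "'a set \<Rightarrow> 'a \<Rightarrow> nat" where
  "weight T v = (\<Sum>t\<in>nbs v \<inter> T. deg t - 1)"

lemma partial_mono: "partial T A c \<Longrightarrow> A' \<subseteq> A \<Longrightarrow> partial T A' c"
  unfolding partial_def by blast

text \<open>The neighbours of each \<open>t\<close> in \<open>T\<close> are all coloured and without
  conflict, so \<open>ex_common_Npos\<close> supplies a colour for \<open>t\<close>. Independence of
  \<open>T\<close> lets these choices be made separately, and a valid colouring results.\<close>

lemma partial_all_False:
  assumes T: "small_indep T" and "partial T (- T) c" shows False
proof -
  have "\<exists>r. \<forall>v\<in>nbs t. r \<in> Npos (see \<sigma> c t v)" if t: "t \<in> T" for t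
  proof -
    have "\<exists>r. \<forall>p \<in> see \<sigma> c t ` nbs t. r \<in> Npos p"
    proof (rule ex_common_Npos)
      show "card (see \<sigma> c t ` nbs t) \<le> 3"
        using T t card_image_le[OF finite_nb, of "see \<sigma> c t" t] unfolding small_indep_def by fastforce
      fix p q assume "p \<in> see \<sigma> c t ` nbs t" "q \<in> see \<sigma> c t ` nbs t"
      then obtain v w where vw: "v \<in> nbs t" "w \<in> nbs t" "p = see \<sigma> c t v" "q = see \<sigma> c t w" by auto
      then have "v \<in> - T" "w \<in> - T" using T t by (auto simp: small_indep_def)
      then show "p \<noteq> neg q" using assms(2) t vw unfolding partial_def by (cases "v = w") auto
    qed simp
    then show ?thesis by auto
  qed
  then obtain f where f: "\<And>t v. t \<in> T \<Longrightarrow> v \<in> nbs t \<Longrightarrow> f t \<in> Npos (see \<sigma> c t v)" by metis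
  define c' where "c' v = (if v \<in> T then f v else c v)" for v
  have "c' v \<in> Npos (see \<sigma> c' v u)" if e: "{u, v} \<in> E" for u v
  proof -
    have uv: "v \<in> nbs u" "u \<in> nbs v" using e by (auto simp: nb_def insert_commute)
    then have ne: "u \<noteq> v" by auto
    have mixed: "c' v \<in> Npos (see \<sigma> c' v u)" if "v \<in> T" "u \<notin> T" "u \<in> nbs v" for u v
      using f[OF that(1,3)] that by (simp add: c'_def see_def)
    consider "u \<in> T" "v \<notin> T" | "v \<in> T" "u \<notin> T" | "u \<notin> T" "v \<notin> T"
      using T uv unfolding small_indep_def by blast
    then show ?thesis
    proof cases
      case 1 then show ?thesis using mixed[of u v] uv in_Npos_see_sym by metis
    next
      case 2 then show ?thesis using mixed[of v u] uv by blast
    next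
      case 3 then show ?thesis using assms(2) uv ne unfolding partial_def
        by (auto simp: c'_def see_def)
    qed
  qed
  then have "valid E \<sigma> c'" by (simp add: valid_def)
  then show False using uncolourable by blast
qed

lemma partial_extend:
  assumes P: "partial T A c" and v: "v \<notin> A"
    and nbr: "\<And>w. w \<in> A \<Longrightarrow> w \<in> nbs v \<Longrightarrow> r \<in> Npos (see \<sigma> c v w)"
    and nf: "r \<notin> forb T A c v"
  shows "partial T (insert v A) (c(v := r))"
proof -
  let ?c = "c(v := r)"
  have see_A: "see \<sigma> ?c x w = see \<sigma> c x w" if "w \<in> A" for x w
    using that v by (auto simp: see_def)
  have adj: "?c v \<in> Npos (see \<sigma> ?c v w)" if "w \<in> A" "w \<in> nbs v" for w
    using nbr[OF that] see_A[OF that(1)] by simp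
  have nconf: "see \<sigma> ?c t v \<noteq> neg (see \<sigma> ?c t w)" if "w \<in> A" "t \<in> T" "v \<in> nbs t" "w \<in> nbs t" for t w
  proof
    assume "see \<sigma> ?c t v = neg (see \<sigma> ?c t w)"
    then have "act (\<sigma> {t, v}) r = neg (see \<sigma> c t w)" using see_A[OF that(1)] by (simp add: see_def)
    then have "r = act (\<sigma> {t, v}) (neg (see \<sigma> c t w))" by (metis act_act)
    moreover have "w \<noteq> v" using that v by auto
    ultimately have "r \<in> forb T A c v" using that by (auto simp: forb_def nb_sym[of t])
    then show False using nf by simp
  qed
  show ?thesis unfolding partial_def
  proof (intro ballI impI)
    fix x w assume xw: "x \<in> insert v A" "w \<in> insert v A" "x \<noteq> w"
    then consider "x = v" "w \<in> A" | "w = v" "x \<in> A" | "x \<in> A" "w \<in> A" by auto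
    then show "(w \<in> nbs x \<longrightarrow> ?c w \<in> Npos (see \<sigma> ?c w x)) \<and>
      (\<forall>t\<in>T. x \<in> nbs t \<longrightarrow> w \<in> nbs t \<longrightarrow> see \<sigma> ?c t x \<noteq> neg (see \<sigma> ?c t w))"
    proof cases
      case 1 then show ?thesis using adj[of w] nconf[of w] in_Npos_see_sym by metis
    next
      case 2 then show ?thesis using adj[of x] nconf[of x] nb_sym by (metis neg_neg)
    next
      case 3
      then have "w \<noteq> v" "x \<noteq> v" using v by auto
      then show ?thesis using 3 xw P see_A unfolding partial_def by auto
    qed
  qed
qed

lemma card_forb: "card (forb T A c v) \<le> weight T v"
proof -
  have "card (forb T A c v) \<le> (\<Sum>t\<in>nbs v \<inter> T.
      card ((\<lambda>w. act (\<sigma> {t, v}) (neg (see \<sigma> c t w))) ` (nbs t \<inter> A - {v})))"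
    unfolding forb_def by (rule card_UN_le) simp
  also have "\<dots> \<le> weight T v" unfolding weight_def
  proof (rule sum_mono)
    fix t assume "t \<in> nbs v \<inter> T"
    then have v: "v \<in> nbs t" by (metis IntD1 nb_sym)
    have "card ((\<lambda>w. act (\<sigma> {t, v}) (neg (see \<sigma> c t w))) ` (nbs t \<inter> A - {v})) \<le> card (nbs t \<inter> A - {v})"
      by (rule card_image_le) simp
    also have "\<dots> \<le> card (nbs t - {v})" by (rule card_mono) auto
    also have "\<dots> = deg t - 1" using v by simp
    finally show "card ((\<lambda>w. act (\<sigma> {t, v}) (neg (see \<sigma> c t w))) ` (nbs t \<inter> A - {v})) \<le> deg t - 1" .
  qed
  finally show ?thesis .
qed

text \<open>The colours of \<open>T\<close> are discarded, yet they witness the absence of conflicts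
  among the neighbours of each vertex of \<open>T\<close>. Deleted edges all meet \<open>u\<close>,
  so every edge consulted survives.\<close>

lemma partial_start:
  assumes "valid E' \<sigma> c" "u \<notin> T" "\<And>e. e \<in> E \<Longrightarrow> e \<notin> E' \<Longrightarrow> u \<in> e"
  shows "partial T (- T - {u}) c"
proof -
  have E': "{v, w} \<in> E'" if "w \<in> nbs v" "v \<noteq> u" "w \<noteq> u" for v w
    using assms(3)[of "{v, w}"] that by (auto simp: nb_def)
  show ?thesis unfolding partial_def
  proof (intro ballI impI conjI)
    fix v w assume vw: "v \<in> - T - {u}" "w \<in> - T - {u}" "v \<noteq> w"
    show "c w \<in> Npos (see \<sigma> c w v)" if "w \<in> nbs v"
      using E'[OF that] assms(1) vw by (auto simp: valid_def)
    show "see \<sigma> c t v \<noteq> neg (see \<sigma> c t w)" if "t \<in> T" "v \<in> nbs t" "w \<in> nbs t" for t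
      using vw that assms(2) by (intro valid_not_conflicting[OF assms(1)] E') auto
  qed
qed

section \<open>Reducible configurations\<close>

text \<open>Otherwise \<open>u\<close> could be recoloured: its neighbours outside \<open>T\<close>
  leave more colours than \<open>T\<close> forbids.\<close>

lemma reducible_weight:
  assumes T: "small_indep T" and u: "u \<notin> T" and D: "nbs u \<inter> T \<noteq> {}"
    and k: "card (nbs u - T) \<le> 2"
  shows "avail (card (nbs u - T)) \<le> weight T u"
proof (rule ccontr)
  assume less: "\<not> ?thesis"
  \<comment> \<open>Edges from \<open>u\<close> to vertices outside \<open>T\<close> stay, so that
    the old colour of \<open>u\<close> keeps these neighbours free of conflict.\<close>
  define E' where "E' = E - {{u, t} | t. t \<in> nbs u \<inter> T}"
  have "E' \<subset> E" using D by (auto simp: E'_def nb_def)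
  then obtain c where c: "valid E' \<sigma> c" using minimal by blast
  have p: "partial T (- T - {u}) c"
    by (rule partial_start[OF c u]) (auto simp: E'_def)
  let ?A = "{r. \<forall>w\<in>nbs u - T. r \<in> Npos (see \<sigma> c u w)}"
  have "{u, w} \<in> E'" if "w \<in> nbs u - T" for w
    using that by (auto simp: E'_def nb_def doubleton_eq_iff)
  then have "avail (card (nbs u - T)) \<le> card ?A"
    by (intro avail_le_card k valid_not_conflicting[OF c]) auto
  then have "card (forb T (- T - {u}) c u) < card ?A"
    using card_forb[of T "- T - {u}" c u] less by linarith
  then obtain r where "r \<in> ?A" "r \<notin> forb T (- T - {u}) c u" using exists_avoiding by blast
  then have "partial T (insert u (- T - {u})) (c(u := r))"
    by (intro partial_extend[OF p]) auto
  moreover have "insert u (- T - {u}) = - T" using u by auto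
  ultimately show False using partial_all_False[OF T] by metis
qed

lemma deg_ne_1: "deg t \<noteq> 1"
proof
  assume t: "deg t = 1"
  then obtain u where u: "nbs t = {u}" using card_1_singletonE by blast
  then have tu: "t \<noteq> u" using irrefl by (metis singletonI)
  have "t \<in> nbs u" using u nb_sym[of t E u] by simp
  then have "E - {{u, t}} \<subset> E" by (auto simp: nb_def)
  then obtain c where c: "valid (E - {{u, t}}) \<sigma> c" using minimal by blast
  have T: "small_indep {t}" using t by (auto simp: small_indep_def)
  have "partial {t} (- {t}) c" unfolding partial_def
  proof (intro ballI impI conjI)
    fix v w assume vw: "v \<in> - {t}" "w \<in> - {t}" "v \<noteq> w"
    show "c w \<in> Npos (see \<sigma> c w v)" if "w \<in> nbs v"
      using c that vw by (auto simp: valid_def nb_def doubleton_eq_iff)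
  qed (use u in auto)
  then show False using partial_all_False[OF T] by blast
qed

lemma small_indep_singleton: "deg t \<le> 3 \<Longrightarrow> small_indep {t}"
  by (auto simp: small_indep_def)

text \<open>If \<open>u\<close> and \<open>v\<close> were adjacent and small, \<open>v\<close> would
  forbid at most 2 colours at \<open>u\<close>, while the at most two other neighbours of
  \<open>u\<close> leave at least 4.\<close>

lemma small_indep_all: "small_indep {t. deg t \<le> 3}"
proof -
  have False if "deg v \<le> 3" "deg u \<le> 3" "u \<in> nbs v" for u v
  proof -
    have "v \<in> nbs u" using that nb_sym by metis
    moreover have "u \<noteq> v" using that by auto
    moreover have "card (nbs u - {v}) \<le> 2" using that \<open>v \<in> nbs u\<close> by simp
    ultimately have "avail (card (nbs u - {v})) \<le> weight {v} u"
      by (intro reducible_weight small_indep_singleton that) auto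
    moreover have "nbs u \<inter> {v} = {v}" using \<open>v \<in> nbs u\<close> by auto
    then have "weight {v} u \<le> 2" using that by (simp add: weight_def)
    ultimately show False by (auto simp: avail_def split: if_splits)
  qed
  then show ?thesis by (auto simp: small_indep_def)
qed

text \<open>Adjacent vertices have colours over different vertices of $SP_9^+$, so \<open>t\<close>
  cannot see them as opposite and can be coloured last.\<close>

lemma no_triangle_deg_2:
  assumes t: "nbs t = {a, b}" and ab: "a \<in> nbs b" shows False
proof -
  have ne: "t \<noteq> a" "t \<noteq> b" "a \<noteq> b" using t ab irrefl by (metis insertCI)+
  have "E - {{t, a}} \<subset> E" using t by (auto simp: nb_def)
  then obtain c where c: "valid (E - {{t, a}}) \<sigma> c" using minimal by blast
  have T: "small_indep {t}" using t ne by (intro small_indep_singleton) simp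
  have cE: "c w \<in> Npos (see \<sigma> c w v)" if "w \<in> nbs v" "v \<noteq> t" "w \<noteq> t" for v w
    using c that by (auto simp: valid_def nb_def doubleton_eq_iff)
  have "fst (c a) \<noteq> fst (c b)" using in_Npos_fst_neq[OF cE[OF ab]] ne
    by (auto simp: see_def act_def split: if_splits)
  then have *: "see \<sigma> c t a \<noteq> neg (see \<sigma> c t b)" "see \<sigma> c t b \<noteq> neg (see \<sigma> c t a)"
    by (auto simp: see_def act_def neg_def split: if_splits)
  have "partial {t} (- {t}) c" unfolding partial_def
    using cE t * by auto
  then show False using partial_all_False[OF T] by blast
qed

subsection \<open>Bad vertices\<close>

definition small :: "'a set" where "small = {t. deg t \<le> 3}"
definition twos :: "'a \<Rightarrow> 'a set" where "twos v = {t \<in> nbs v. deg t = 2}"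
definition threes :: "'a \<Rightarrow> 'a set" where "threes v = {t \<in> nbs v. deg t = 3}"
definition bigs :: "'a \<Rightarrow> 'a set" where "bigs v = nbs v - small"

text \<open>After feeding its neighbours of degree 2, a \<open>bad4\<close> vertex has charge 120 -
  102 - 21 = -3 and a \<open>bad6\<close> vertex 180 - 102 - 84 = -6.\<close>

definition bad4 :: "'a \<Rightarrow> bool" where
  "bad4 x \<longleftrightarrow> deg x = 4 \<and> card (twos x) = 1 \<and> card (bigs x) = 3"
definition bad6 :: "'a \<Rightarrow> bool" where
  "bad6 x \<longleftrightarrow> deg x = 6 \<and> card (twos x) = 4 \<and> card (bigs x) = 2"
definition bad :: "'a \<Rightarrow> bool" where "bad x \<longleftrightarrow> bad4 x \<or> bad6 x"

lemma small_indep_small: "small_indep small"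
  unfolding small_def by (rule small_indep_all)

lemma deg_nb_ge_2: "w \<in> nbs v \<Longrightarrow> 2 \<le> deg w"
proof -
  assume "w \<in> nbs v"
  then have "v \<in> nbs w" using nb_sym by metis
  then have "deg w \<noteq> 0" by auto
  then show ?thesis using deg_ne_1[of w] by linarith
qed

lemma finite_nb_classes [simp]: "finite (twos v)" "finite (threes v)" "finite (bigs v)"
  by (auto simp: twos_def threes_def bigs_def)

lemma nbs_inter_small: "nbs v \<inter> small = twos v \<union> threes v"
proof -
  have "deg t = 2 \<or> deg t = 3" if "t \<in> nbs v" "t \<in> small" for t
    using deg_nb_ge_2[OF that(1)] that(2) by (auto simp: small_def)
  then show ?thesis by (auto simp: twos_def threes_def small_def)
qed

lemma nbs_split: "nbs v = twos v \<union> threes v \<union> bigs v"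
  using nbs_inter_small[of v] by (auto simp: bigs_def)

lemma classes_disjoint: "twos v \<inter> threes v = {}" "(twos v \<union> threes v) \<inter> bigs v = {}"
  by (auto simp: twos_def threes_def bigs_def small_def)

lemma deg_split: "deg v = card (twos v) + card (threes v) + card (bigs v)"
  using classes_disjoint[of v] by (simp add: nbs_split card_Un_disjoint)

lemma weight_small: "weight small v = card (twos v) + 2 * card (threes v)"
proof -
  have "weight small v = (\<Sum>t\<in>twos v. deg t - 1) + (\<Sum>t\<in>threes v. deg t - 1)"
    unfolding weight_def nbs_inter_small by (rule sum.union_disjoint) (auto simp: classes_disjoint)
  also have "\<dots> = (\<Sum>t\<in>twos v. 1) + (\<Sum>t\<in>threes v. 2)"
    by (intro arg_cong2[where f = "(+)"] sum.cong) (auto simp: twos_def threes_def)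
  finally show ?thesis by simp
qed

lemma bad_threes: "bad x \<Longrightarrow> threes x = {}"
  using deg_split[of x] by (auto simp: bad_def bad4_def bad6_def)

lemma bad_not_small: "bad x \<Longrightarrow> x \<notin> small"
  by (auto simp: bad_def bad4_def bad6_def small_def)

lemma bad_small: "bad x \<Longrightarrow> t \<in> nbs x \<Longrightarrow> t \<in> small \<Longrightarrow> deg t = 2"
  using nbs_inter_small[of x] bad_threes[of x] by (auto simp: twos_def)

lemma nbs_deg_2:
  assumes "deg t = 2" "a \<in> nbs t" "b \<in> nbs t" "a \<noteq> b" shows "nbs t = {a, b}"
proof -
  have "{a, b} = nbs t" using assms by (intro card_subset_eq) auto
  then show ?thesis by simp
qed

text \<open>A small neighbour of a bad vertex has degree 2, so a shared one would close a triangle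
  excluded by \<open>no_triangle_deg_2\<close>.\<close>

lemma no_common_small:
  assumes "bad x" "u \<in> nbs x" "t \<in> small" "t \<in> nbs x" shows "u \<notin> nbs t"
proof
  assume "u \<in> nbs t"
  moreover have "x \<in> nbs t" using assms nb_sym by metis
  moreover have "u \<noteq> x" using assms by auto
  ultimately show False using bad_small[OF assms(1,4,3)] nbs_deg_2 no_triangle_deg_2 assms(2) by metis
qed

section \<open>Recolouring around bad vertices\<close>

lemma forb_insert:
  assumes "w \<notin> A"
  shows "forb U (insert w A) (c(w := q)) v \<subseteq>
    forb U A c v \<union> {act (\<sigma> {t, v}) (neg (act (\<sigma> {t, w}) q)) | t. t \<in> U \<and> t \<in> nbs v \<and> w \<in> nbs t}"
proof
  fix r assume "r \<in> forb U (insert w A) (c(w := q)) v"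
  then obtain t w' where r: "t \<in> nbs v" "t \<in> U" "w' \<in> nbs t" "w' \<in> insert w A" "w' \<noteq> v"
    "r = act (\<sigma> {t, v}) (neg (see \<sigma> (c(w := q)) t w'))" by (auto simp: forb_def)
  show "r \<in> forb U A c v \<union> {act (\<sigma> {t, v}) (neg (act (\<sigma> {t, w}) q)) | t. t \<in> U \<and> t \<in> nbs v \<and> w \<in> nbs t}"
  proof (cases "w' = w")
    case True then show ?thesis using r by (auto simp: see_def)
  next
    case False
    then have "see \<sigma> (c(w := q)) t w' = see \<sigma> c t w'" by (simp add: see_def)
    then show ?thesis using r False by (auto simp: forb_def)
  qed
qed

lemma forb_insert_same:
  assumes "w \<notin> A" "\<And>t. t \<in> U \<Longrightarrow> t \<in> nbs v \<Longrightarrow> w \<notin> nbs t"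
  shows "forb U (insert w A) (c(w := q)) v \<subseteq> forb U A c v"
  using forb_insert[OF assms(1), of U c q v] assms(2) by auto

text \<open>The colours of \<open>u\<close> after which \<open>x\<close>, coloured later and with
  its other big neighbours fixed, could only receive colours of \<open>R\<close>.\<close>

definition blocked :: "('a \<Rightarrow> col) \<Rightarrow> 'a \<Rightarrow> 'a \<Rightarrow> col set \<Rightarrow> col set" where
  "blocked c u x R = {q. \<forall>r. r \<in> Npos (act (\<sigma> {x, u}) q) \<longrightarrow>
     (\<forall>w\<in>bigs x - {u}. r \<in> Npos (see \<sigma> c x w)) \<longrightarrow> r \<in> R}"

lemma card_blocked:
  assumes x: "bad x" "u \<in> bigs x" and c: "valid {e \<in> E. u \<notin> e} \<sigma> c"
    and R: "card R \<le> weight small x"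
  shows "card (blocked c u x R) \<le> 3"
proof -
  have wx: "weight small x = card (twos x)" using bad_threes[OF x(1)] by (simp add: weight_small)
  have ux: "u \<noteq> x" using x by (auto simp: bigs_def)
  consider "bad4 x" | "bad6 x" using x by (auto simp: bad_def)
  then show ?thesis
  proof cases
    case 1
    then have "card (bigs x - {u}) = 2" using x by (simp add: bad4_def)
    then obtain a b where ab: "a \<noteq> b" "bigs x - {u} = {a, b}" by (auto simp: card_2_iff)
    \<comment> \<open>The edges from \<open>x\<close> to \<open>a\<close> and \<open>b\<close>
      survive the removal of \<open>u\<close>, so the old colour of \<open>x\<close> excludes a
      conflict.\<close>
    have "see \<sigma> c x a \<noteq> neg (see \<sigma> c x b)"
      using ab(2) ux by (intro valid_not_conflicting[OF c]) (auto simp: bigs_def nb_def)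
    then have "card {q. Npos q \<inter> (Npos (see \<sigma> c x a) \<inter> Npos (see \<sigma> c x b)) \<subseteq> R} \<le> 3"
      using R wx 1 by (intro card_blocked_by_two) (auto simp: bad4_def)
    moreover have "blocked c u x R = {q. Npos (act (\<sigma> {x, u}) q) \<inter> (Npos (see \<sigma> c x a) \<inter> Npos (see \<sigma> c x b)) \<subseteq> R}"
      by (auto simp: blocked_def ab(2))
    ultimately show ?thesis
      using card_act_Collect[of "\<lambda>q. Npos q \<inter> (Npos (see \<sigma> c x a) \<inter> Npos (see \<sigma> c x b)) \<subseteq> R"] by simp
  next
    case 2
    then have "card (bigs x - {u}) = 1" using x by (simp add: bad6_def)
    then obtain a where a: "bigs x - {u} = {a}" using card_1_singletonE by blast
    have "card {q. card (Npos q \<inter> Npos (see \<sigma> c x a) - R) \<le> 0} \<le> 2"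
      using R wx 2 by (intro card_blocked_by_one) (auto simp: bad6_def)
    moreover have "blocked c u x R = {q. card (Npos (act (\<sigma> {x, u}) q) \<inter> Npos (see \<sigma> c x a) - R) \<le> 0}"
      by (auto simp: blocked_def a)
    ultimately show ?thesis
      using card_act_Collect[of "\<lambda>q. card (Npos q \<inter> Npos (see \<sigma> c x a) - R) \<le> 0"] by simp
  qed
qed

lemma colour_without:
  assumes "x \<in> nbs u"
  obtains c where "valid {e \<in> E. u \<notin> e} \<sigma> c"
proof -
  have "{u, x} \<in> E" using assms by (simp add: nb_def)
  then have "{e \<in> E. u \<notin> e} \<subset> E" by auto
  then show ?thesis using minimal that by blast
qed

text \<open>Colour \<open>u\<close> first, then \<open>x\<close>. The vertex \<open>z\<close> leaves
  9 colours at \<open>u\<close>; with weight at most 5, at most 5 are forbidden and 3 blocked by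
  \<open>x\<close>, so one remains.\<close>

lemma weight_bad_neighbour:
  assumes u: "u \<notin> small" and big: "bigs u = {x, z}" and xz: "x \<noteq> z" and x: "bad x"
  shows "6 \<le> weight small u"
proof (rule ccontr)
  assume w: "\<not> ?thesis"
  have xu: "x \<in> nbs u" using big by (auto simp: bigs_def)
  then have ux: "u \<in> nbs x" using nb_sym by metis
  then have ux': "u \<in> bigs x" "u \<noteq> x" using u by (auto simp: bigs_def)
  obtain c where c: "valid {e \<in> E. u \<notin> e} \<sigma> c" using colour_without[OF xu] .
  define A where "A = - small - {u, x}"
  have pA: "partial small A c" by (rule partial_mono[OF partial_start[OF c u]]) (auto simp: A_def)
  let ?R = "forb small A c x"
  have "card (forb small A c u \<union> blocked c u x ?R) \<le> card (forb small A c u) + card (blocked c u x ?R)"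
    by (rule card_Un_le)
  also have "\<dots> \<le> 5 + 3"
    using card_forb[of small A c u] w card_blocked[OF x ux'(1) c card_forb] by (intro add_mono) auto
  also have "\<dots> < card (Npos (see \<sigma> c u z))" by (simp add: card_Npos)
  finally obtain q where q: "q \<in> Npos (see \<sigma> c u z)" "q \<notin> forb small A c u" "q \<notin> blocked c u x ?R"
    using exists_avoiding by blast
  let ?c = "c(u := q)"
  have p1: "partial small (insert u A) ?c"
  proof (rule partial_extend[OF pA _ _ q(2)])
    show "q \<in> Npos (see \<sigma> c u w)" if "w \<in> A" "w \<in> nbs u" for w
    proof -
      have "w \<in> bigs u" using that by (auto simp: A_def bigs_def)
      then have "w = z" using big that by (auto simp: A_def)
      then show ?thesis using q by simp
    qed
  qed (simp add: A_def)
  obtain r where r: "r \<in> Npos (act (\<sigma> {x, u}) q)" "\<And>w. w \<in> bigs x - {u} \<Longrightarrow> r \<in> Npos (see \<sigma> c x w)" "r \<notin> ?R"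
    using q(3) by (auto simp: blocked_def)
  have "partial small (insert x (insert u A)) (?c(x := r))"
  proof (rule partial_extend[OF p1])
    show "x \<notin> insert u A" using ux' by (auto simp: A_def)
    show "r \<in> Npos (see \<sigma> ?c x w)" if "w \<in> insert u A" "w \<in> nbs x" for w
    proof (cases "w = u")
      case True then show ?thesis using r by (simp add: see_def)
    next
      case False
      then have "w \<in> bigs x - {u}" using that by (auto simp: A_def bigs_def)
      then show ?thesis using r(2)[of w] False by (simp add: see_def)
    qed
    \<comment> \<open>No small vertex is adjacent to both \<open>u\<close> and \<open>x\<close>, so
      the new colour of \<open>u\<close> forbids nothing more at \<open>x\<close>.\<close>
    have "forb small (insert u A) ?c x \<subseteq> ?R"
      using no_common_small[OF x ux] by (intro forb_insert_same) (auto simp: A_def)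
    then show "r \<notin> forb small (insert u A) ?c x" using r by auto
  qed
  moreover have "insert x (insert u A) = - small" using u bad_not_small[OF x] by (auto simp: A_def)
  ultimately show False using partial_all_False[OF small_indep_small] by metis
qed

text \<open>The vertices are recoloured in the order \<open>u\<close>, \<open>y\<close>, \<open>x\<close>; the last hypothesis accounts for
  small vertices adjacent to both \<open>x\<close> and \<open>y\<close>.\<close>

lemma recolour_three:
  assumes u: "u \<notin> small" and big: "bigs u = {x, y, z}" and d: "x \<noteq> y" "x \<noteq> z" "y \<noteq> z"
    and bad: "bad x" "bad y" and c: "valid {e \<in> E. u \<notin> e} \<sigma> c"
    and A: "A = - small - {u, x, y}"
    and q: "q \<in> Npos (see \<sigma> c u z)" "q \<notin> forb small A c u"
    and ry: "ry \<in> Npos (act (\<sigma> {y, u}) q)" "\<And>w. w \<in> bigs y - {u, x} \<Longrightarrow> ry \<in> Npos (see \<sigma> c y w)"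
      "ry \<notin> forb small A c y"
    and rx: "rx \<in> Npos (act (\<sigma> {x, u}) q)" "\<And>w. w \<in> bigs x - {u, y} \<Longrightarrow> rx \<in> Npos (see \<sigma> c x w)"
      "y \<in> nbs x \<Longrightarrow> rx \<in> Npos (act (\<sigma> {x, y}) ry)" "rx \<notin> forb small A c x"
      "\<And>t. t \<in> small \<Longrightarrow> t \<in> nbs x \<Longrightarrow> y \<in> nbs t \<Longrightarrow> rx \<noteq> act (\<sigma> {t, x}) (neg (act (\<sigma> {t, y}) ry))"
  shows False
proof -
  have xu: "x \<in> nbs u" and yu: "y \<in> nbs u" using big by (auto simp: bigs_def)
  then have ux: "u \<in> nbs x" and uy: "u \<in> nbs y" using nb_sym by metis+
  then have ne: "u \<noteq> x" "u \<noteq> y" by auto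
  have pA: "partial small A c" by (rule partial_mono[OF partial_start[OF c u]]) (auto simp: A)
  let ?c = "c(u := q)"
  have p1: "partial small (insert u A) ?c"
  proof (rule partial_extend[OF pA _ _ q(2)])
    show "q \<in> Npos (see \<sigma> c u w)" if "w \<in> A" "w \<in> nbs u" for w
    proof -
      have "w \<in> bigs u" using that by (auto simp: A bigs_def)
      then have "w = z" using big that by (auto simp: A)
      then show ?thesis using q by simp
    qed
  qed (simp add: A)
  let ?c' = "?c(y := ry)"
  have p2: "partial small (insert y (insert u A)) ?c'"
  proof (rule partial_extend[OF p1])
    show "y \<notin> insert u A" using ne by (auto simp: A)
    show "ry \<in> Npos (see \<sigma> ?c y w)" if "w \<in> insert u A" "w \<in> nbs y" for w
    proof (cases "w = u")
      case True then show ?thesis using ry by (simp add: see_def)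
    next
      case False
      then have "w \<in> bigs y - {u, x}" using that by (auto simp: A bigs_def)
      then show ?thesis using ry(2)[of w] False by (simp add: see_def)
    qed
    have "forb small (insert u A) ?c y \<subseteq> forb small A c y"
      using no_common_small[OF bad(2) uy] by (intro forb_insert_same) (auto simp: A)
    then show "ry \<notin> forb small (insert u A) ?c y" using ry by auto
  qed
  have "partial small (insert x (insert y (insert u A))) (?c'(x := rx))"
  proof (rule partial_extend[OF p2])
    show "x \<notin> insert y (insert u A)" using ne d by (auto simp: A)
    show "rx \<in> Npos (see \<sigma> ?c' x w)" if w: "w \<in> insert y (insert u A)" "w \<in> nbs x" for w
    proof -
      consider "w = u" | "w = y" | "w \<in> A" "w \<noteq> u" "w \<noteq> y" using w(1) by blast
      then show ?thesis
      proof cases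
        case 1 then show ?thesis using rx ne by (simp add: see_def)
      next
        case 2 then show ?thesis using rx(3) w by (simp add: see_def)
      next
        case 3
        then have "w \<in> bigs x - {u, y}" using w by (auto simp: A bigs_def)
        then show ?thesis using rx(2)[of w] 3 by (simp add: see_def)
      qed
    qed
    \<comment> \<open>New conflicts at \<open>x\<close> could only pass through small vertices
      shared with \<open>u\<close>, which do not exist, or with \<open>y\<close>, which
      \<open>rx\<close> avoids.\<close>
    have "forb small (insert u A) ?c x \<subseteq> forb small A c x"
      using no_common_small[OF bad(1) ux] by (intro forb_insert_same) (auto simp: A)
    moreover have "y \<notin> insert u A" using ne by (auto simp: A)
    ultimately show "rx \<notin> forb small (insert y (insert u A)) ?c' x"
      using forb_insert[of y "insert u A" small ?c ry x] rx(4,5) by blast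
  qed
  moreover have "insert x (insert y (insert u A)) = - small"
    using u bad bad_not_small by (auto simp: A)
  ultimately show False using partial_all_False[OF small_indep_small] by metis
qed

text \<open>Of the 9 colours that \<open>z\<close> leaves at \<open>u\<close>, at most 2 are
  forbidden and at most 3 blocked by each of \<open>x\<close> and \<open>y\<close>. The choices at
  \<open>x\<close> and \<open>y\<close> do not interact.\<close>

lemma two_bad_apart:
  assumes u: "u \<notin> small" "weight small u \<le> 2" and big: "bigs u = {x, y, z}" and d: "x \<noteq> y" "x \<noteq> z" "y \<noteq> z"
    and bad: "bad x" "bad y" and nadj: "y \<notin> nbs x"
    and nsh: "\<And>t. t \<in> small \<Longrightarrow> t \<in> nbs x \<Longrightarrow> y \<in> nbs t \<Longrightarrow> False"
  shows False
proof -
  have xu: "x \<in> nbs u" and yu: "y \<in> nbs u" using big by (auto simp: bigs_def)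
  then have ux: "u \<in> bigs x" and uy: "u \<in> bigs y" using u unfolding bigs_def by (metis DiffI nb_sym)+
  obtain c where c: "valid {e \<in> E. u \<notin> e} \<sigma> c" using colour_without[OF xu] .
  define A where "A = - small - {u, x, y}"
  let ?Rx = "forb small A c x" and ?Ry = "forb small A c y"
  have "card (forb small A c u \<union> blocked c u x ?Rx \<union> blocked c u y ?Ry)
      \<le> card (forb small A c u) + card (blocked c u x ?Rx) + card (blocked c u y ?Ry)"
    by (rule card_Un3_le)
  also have "\<dots> \<le> 2 + 3 + 3"
    using card_forb[of small A c u] u(2) card_blocked[OF bad(1) ux c card_forb] card_blocked[OF bad(2) uy c card_forb]
    by (intro add_mono) auto
  also have "\<dots> < card (Npos (see \<sigma> c u z))" by (simp add: card_Npos)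
  finally obtain q where q: "q \<in> Npos (see \<sigma> c u z)" "q \<notin> forb small A c u" "q \<notin> blocked c u x ?Rx"
      "q \<notin> blocked c u y ?Ry"
    using exists_avoiding by blast
  obtain rx where rx: "rx \<in> Npos (act (\<sigma> {x, u}) q)" "\<And>w. w \<in> bigs x - {u} \<Longrightarrow> rx \<in> Npos (see \<sigma> c x w)" "rx \<notin> ?Rx"
    using q(3) by (auto simp: blocked_def)
  obtain ry where ry: "ry \<in> Npos (act (\<sigma> {y, u}) q)" "\<And>w. w \<in> bigs y - {u} \<Longrightarrow> ry \<in> Npos (see \<sigma> c y w)" "ry \<notin> ?Ry"
    using q(4) by (auto simp: blocked_def)
  show False
    by (rule recolour_three[OF u(1) big d bad c A_def q(1,2) ry(1) _ ry(3) rx(1) _ _ rx(3)])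
      (use rx(2) ry(2) nadj nsh in auto)
qed

text \<open>The shared vertex \<open>t\<close> will forbid one colour at \<open>x\<close> once
  \<open>y\<close> is coloured. So \<open>u\<close> gets a colour that leaves \<open>x\<close> two
  choices: 2 + 2 + 3 excluded colours are fewer than 9.\<close>

lemma bad6_sharing:
  assumes u: "u \<notin> small" "weight small u \<le> 2" and big: "bigs u = {x, y, z}" and d: "x \<noteq> y" "x \<noteq> z" "y \<noteq> z"
    and bad: "bad6 x" "bad y" and t: "t \<in> small" "t \<in> nbs x" "y \<in> nbs t"
  shows False
proof -
  have badx: "bad x" using bad by (simp add: bad_def)
  have xu: "x \<in> nbs u" and yu: "y \<in> nbs u" using big by (auto simp: bigs_def)
  then have ux: "u \<in> bigs x" and uy: "u \<in> bigs y" using u unfolding bigs_def by (metis DiffI nb_sym)+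
  have nadj: "y \<notin> nbs x" using no_common_small[OF badx _ t(1,2), of y] t(3) by blast
  have nadj': "x \<notin> nbs y" using nadj nb_sym by metis
  have "x \<in> nbs t" using t(2) nb_sym by metis
  then have nbt: "nbs t = {x, y}" by (intro nbs_deg_2 bad_small[OF badx] t d)
  obtain c where c: "valid {e \<in> E. u \<notin> e} \<sigma> c" using colour_without[OF xu] .
  define A where "A = - small - {u, x, y}"
  let ?Rx = "forb small A c x" and ?Ry = "forb small A c y"
  \<comment> \<open>Both neighbours of \<open>t\<close> are uncoloured as yet, so \<open>t\<close>
    contributes nothing and the bound drops from 4 to 3.\<close>
  have "?Rx \<subseteq> forb (small - {t}) A c x" unfolding forb_def using nbt by (auto simp: A_def)
  then have "card ?Rx \<le> card (forb (small - {t}) A c x)" by (intro card_mono) auto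
  also have "\<dots> \<le> weight (small - {t}) x" by (rule card_forb)
  also have "\<dots> = weight small x - 1"
  proof -
    have "nbs x \<inter> small - {t} = nbs x \<inter> (small - {t})" by auto
    then have "weight small x = (deg t - 1) + weight (small - {t}) x"
      using sum.remove[of "nbs x \<inter> small" t "\<lambda>t. deg t - 1"] t by (simp add: weight_def)
    then show ?thesis using bad_small[OF badx t(2,1)] by simp
  qed
  also have "\<dots> = 3" using bad bad_threes[OF badx] by (simp add: weight_small bad6_def)
  finally have Rx: "card ?Rx \<le> 3" .
  have "card (bigs x - {u}) = 1" using bad ux by (simp add: bad6_def)
  then obtain a where a: "bigs x - {u} = {a}" using card_1_singletonE by blast
  define F where "F = {q. card (Npos (act (\<sigma> {x, u}) q) \<inter> Npos (see \<sigma> c x a) - ?Rx) \<le> 1}"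
  have F: "card F \<le> 2" unfolding F_def
    using card_act_Collect[of "\<lambda>q. card (Npos q \<inter> Npos (see \<sigma> c x a) - ?Rx) \<le> 1"]
      card_blocked_by_one[of ?Rx 1] Rx by simp
  have "card (forb small A c u \<union> F \<union> blocked c u y ?Ry)
      \<le> card (forb small A c u) + card F + card (blocked c u y ?Ry)"
    by (rule card_Un3_le)
  also have "\<dots> \<le> 2 + 2 + 3"
    using card_forb[of small A c u] u(2) F card_blocked[OF bad(2) uy c card_forb]
    by (intro add_mono) auto
  also have "\<dots> < card (Npos (see \<sigma> c u z))" by (simp add: card_Npos)
  finally obtain q where q: "q \<in> Npos (see \<sigma> c u z)" "q \<notin> forb small A c u" "q \<notin> F"
      "q \<notin> blocked c u y ?Ry"
    using exists_avoiding by blast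
  obtain ry where ry: "ry \<in> Npos (act (\<sigma> {y, u}) q)" "\<And>w. w \<in> bigs y - {u} \<Longrightarrow> ry \<in> Npos (see \<sigma> c y w)" "ry \<notin> ?Ry"
    using q(4) by (auto simp: blocked_def)
  let ?X = "Npos (act (\<sigma> {x, u}) q) \<inter> Npos (see \<sigma> c x a) - ?Rx"
  \<comment> \<open>Distinct positive neighbours of one colour lie over distinct vertices, so one of
    the two choices is neither \<open>ry\<close> nor its opposite.\<close>
  have "\<exists>rx\<in>?X. fst rx \<noteq> fst ry"
  proof (rule ccontr)
    assume "\<not> ?thesis"
    then have "p = p'" if "p \<in> ?X" "p' \<in> ?X" for p p'
      using inj_onD[OF inj_fst_Npos, of p p' "see \<sigma> c x a"] that by auto
    then have "card ?X \<le> 1" by (auto simp: card_le_Suc0_iff_eq)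
    then show False using q(3) by (simp add: F_def)
  qed
  then obtain rx where rx: "rx \<in> ?X" "fst rx \<noteq> fst ry" by blast
  show False
  proof (rule recolour_three[OF u(1) big d badx bad(2) c A_def q(1,2) ry(1) _ ry(3), of rx])
    show "rx \<noteq> act (\<sigma> {t, x}) (neg (act (\<sigma> {t, y}) ry))" for t using rx(2) by auto
    show "rx \<in> Npos (see \<sigma> c x w)" if "w \<in> bigs x - {u, y}" for w
    proof -
      have "w = a" using that a by blast
      then show ?thesis using rx(1) by simp
    qed
  qed (use rx(1) ry(2) nadj in auto)
qed

text \<open>The colour of \<open>u\<close> need only avoid conflicts with the third big neighbours
  \<open>px\<close> and \<open>py\<close>. Then \<open>y\<close> has at least 3 choices, and at most
  3 colours of \<open>y\<close> block \<open>x\<close>; the two sets are shown to differ.\<close>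

lemma two_bad4_adjacent:
  assumes u: "u \<notin> small" "weight small u \<le> 2" and big: "bigs u = {x, y, z}" and d: "x \<noteq> y" "x \<noteq> z" "y \<noteq> z"
    and bad: "bad4 x" "bad4 y" and adj: "y \<in> nbs x"
  shows False
proof -
  have bad': "bad x" "bad y" using bad by (auto simp: bad_def)
  have xu: "x \<in> nbs u" and yu: "y \<in> nbs u" using big by (auto simp: bigs_def)
  then have ux: "u \<in> bigs x" and uy: "u \<in> bigs y" using u unfolding bigs_def by (metis DiffI nb_sym)+
  have ne: "u \<noteq> x" "u \<noteq> y" using xu yu by auto
  have yx: "y \<in> bigs x" using adj bad_not_small[OF bad'(2)] by (simp add: bigs_def)
  have xy: "x \<in> bigs y" using adj bad_not_small[OF bad'(1)] unfolding bigs_def by (metis DiffI nb_sym)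
  have third: "\<exists>p. bigs v - {u, w} = {p}" if "bad4 v" "u \<in> bigs v" "w \<in> bigs v" "u \<noteq> w" for v w
  proof -
    have "card (bigs v - {u, w}) = 1" using that by (subst card_Diff_subset) (auto simp: bad4_def)
    then show ?thesis using card_1_singletonE by blast
  qed
  obtain px where px: "bigs x - {u, y} = {px}" using third bad(1) ux yx ne by blast
  obtain py where py: "bigs y - {u, x} = {py}" using third bad(2) uy xy ne by blast
  obtain c where c: "valid {e \<in> E. u \<notin> e} \<sigma> c" using colour_without[OF xu] .
  define A where "A = - small - {u, x, y}"
  let ?Rx = "forb small A c x" and ?Ry = "forb small A c y"
  have R: "card (forb small A c v) \<le> 1" if "bad4 v" for v
  proof -
    have "bad v" using that by (simp add: bad_def)
    then show ?thesis using card_forb[of small A c v] bad_threes[of v] that by (simp add: weight_small bad4_def)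
  qed
  let ?sx = "see \<sigma> c x px" and ?sy = "see \<sigma> c y py"
  let ?cx = "act (\<sigma> {x, u}) (neg ?sx)" and ?cy = "act (\<sigma> {y, u}) (neg ?sy)"
  have "card (forb small A c u \<union> {?cx} \<union> {?cy}) \<le> card (forb small A c u) + card {?cx} + card {?cy}"
    by (rule card_Un3_le)
  also have "\<dots> \<le> 4" using card_forb[of small A c u] u(2) by simp
  also have "4 < card (Npos (see \<sigma> c u z))" by (simp add: card_Npos)
  finally obtain q where q: "q \<in> Npos (see \<sigma> c u z)" "q \<notin> forb small A c u" "q \<noteq> ?cx" "q \<noteq> ?cy"
    using exists_avoiding by blast
  let ?qx = "act (\<sigma> {x, u}) q" and ?qy = "act (\<sigma> {y, u}) q"
  have qx: "?qx \<noteq> neg ?sx" and qy: "?qy \<noteq> neg ?sy" using q(3,4) by (metis act_act)+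
  let ?B = "{r. Npos (act (\<sigma> {x, y}) r) \<inter> (Npos ?qx \<inter> Npos ?sx) \<subseteq> ?Rx}"
  let ?L = "Npos ?qy \<inter> Npos ?sy - ?Ry"
  have B: "card ?B \<le> 3"
    using card_act_Collect[of "\<lambda>r. Npos r \<inter> (Npos ?qx \<inter> Npos ?sx) \<subseteq> ?Rx"]
      card_blocked_by_two[OF qx R[OF bad(1)]] by simp
  have L: "3 \<le> card ?L"
    using card_Npos2_ge[OF qy] diff_card_le_card_Diff[of ?Ry "Npos ?qy \<inter> Npos ?sy"] R[OF bad(2)] by simp
  \<comment> \<open>One blocking colour is that seen from \<open>x\<close> as opposite to the colour
    of \<open>u\<close>. It lies over the same vertex as \<open>q\<close>, so it is not allowed at
    \<open>y\<close>, which is adjacent to \<open>u\<close>.\<close>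
  have "\<not> ?L \<subseteq> ?B"
  proof
    assume "?L \<subseteq> ?B"
    then have "?L = ?B" using B L card_seteq[of ?B ?L] by auto
    moreover have "Npos (neg ?qx) \<inter> Npos ?qx = {}" using Npos_neg_disjoint by blast
    then have "act (\<sigma> {x, y}) (neg ?qx) \<in> ?B" by auto
    ultimately have "act (\<sigma> {x, y}) (neg ?qx) \<in> Npos ?qy" by blast
    then show False using in_Npos_fst_neq by fastforce
  qed
  then obtain ry where ry: "ry \<in> ?L" "ry \<notin> ?B" by blast
  then obtain rx where rx: "rx \<in> Npos (act (\<sigma> {x, y}) ry)" "rx \<in> Npos ?qx" "rx \<in> Npos ?sx" "rx \<notin> ?Rx" by blast
  show False
  proof (rule recolour_three[OF u(1) big d bad' c A_def q(1,2), of ry rx])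
    show "rx \<noteq> act (\<sigma> {t, x}) (neg (act (\<sigma> {t, y}) ry))" for t
      using in_Npos_fst_neq[OF rx(1)] by auto
  qed (use rx ry px py in auto)
qed

text \<open>A \<open>bad6\<close> vertex has weight 4, below the 6 demanded by
  \<open>weight_bad_neighbour\<close>.\<close>

lemma bigs_bad6:
  assumes "bad6 x" "y \<in> bigs x" "bad y" shows False
proof -
  have badx: "bad x" using assms by (simp add: bad_def)
  have "card (bigs x - {y}) = 1" using assms by (simp add: bad6_def)
  then obtain z where "bigs x - {y} = {z}" using card_1_singletonE by blast
  then have "bigs x = {y, z}" "y \<noteq> z" using assms by auto
  then have "6 \<le> weight small x" using weight_bad_neighbour bad_not_small[OF badx] assms by blast
  then show False using assms bad_threes[OF badx] by (simp add: weight_small bad6_def)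
qed

text \<open>By the two preceding recolourings, any two of the three bad neighbours share a small
  vertex. Then \<open>x\<close> has two neighbours of degree 2, hence is \<open>bad6\<close>, which
  \<open>bad6_sharing\<close> excludes.\<close>

lemma not_three_bad:
  assumes u: "u \<notin> small" "weight small u \<le> 2" and k: "card (bigs u) = 3" and bad: "\<And>x. x \<in> bigs u \<Longrightarrow> bad x"
  shows False
proof -
  obtain x y z where xyz: "bigs u = {x, y, z}" and d: "x \<noteq> y" "y \<noteq> z" "x \<noteq> z"
    using k by (auto simp: card_3_iff)
  have share: "\<exists>t. t \<in> small \<and> t \<in> nbs a \<and> b \<in> nbs t" if ab: "bigs u = {a, b, e}" "a \<noteq> b" "a \<noteq> e" "b \<noteq> e" for a b e
  proof (rule ccontr)
    assume n: "\<not> ?thesis"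
    have bads: "bad a" "bad b" using bad ab by auto
    show False
    proof (cases "b \<in> nbs a")
      case True
      then have "b \<in> bigs a" "a \<in> bigs b"
        using bad_not_small bads unfolding bigs_def by (metis DiffI nb_sym)+
      then have "bad4 a" "bad4 b" using bigs_bad6 bads unfolding bad_def by blast+
      then show False using two_bad4_adjacent[OF u ab] True by blast
    next
      case False
      then show False using two_bad_apart[OF u ab bads False] n by blast
    qed
  qed
  obtain t where t: "t \<in> small" "t \<in> nbs x" "y \<in> nbs t" using share[OF xyz] d by auto
  have "bigs u = {x, z, y}" using xyz by auto
  then obtain t' where t': "t' \<in> small" "t' \<in> nbs x" "z \<in> nbs t'" using share d by metis
  have badx: "bad x" and bady: "bad y" using bad xyz by auto
  have deg2: "deg t = 2" "deg t' = 2" using bad_small[OF badx] t t' by auto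
  have "x \<in> nbs t" "x \<in> nbs t'" using t t' nb_sym by metis+
  \<comment> \<open>Having degree 2, \<open>t\<close> is adjacent to \<open>x\<close> and
    \<open>y\<close> only, while \<open>t'\<close> is adjacent to \<open>z\<close>.\<close>
  then have "t \<noteq> t'" using nbs_deg_2[OF deg2(1), of x y] t t' d by auto
  moreover have "{t, t'} \<subseteq> twos x" using t t' deg2 by (auto simp: twos_def)
  ultimately have "2 \<le> card (twos x)" using card_mono[of "twos x" "{t, t'}"] by simp
  then have "bad6 x" using badx by (auto simp: bad_def bad4_def)
  then show False using bad6_sharing[OF u xyz d(1,3,2) _ bady t] by blast
qed

subsection \<open>Discharging\<close>

definition support :: "'a set" where "support = \<Union>E"

lemma finite_support [simp]: "finite support"
  unfolding support_def using finE two by (metis card.infinite finite_Union zero_neq_numeral)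

lemma nbs_support: "w \<in> nbs v \<Longrightarrow> w \<in> support" "w \<in> nbs v \<Longrightarrow> v \<in> support"
  by (auto simp: nb_def support_def)

lemma deg_support: "v \<in> support \<Longrightarrow> 2 \<le> deg v"
proof -
  assume "v \<in> support"
  then obtain e where e: "e \<in> E" "v \<in> e" by (auto simp: support_def)
  then obtain w where "e = {v, w}" using two[OF e(1)] by (auto simp: card_2_iff)
  then have "v \<in> nbs w" using e by (simp add: nb_def insert_commute)
  then show ?thesis by (rule deg_nb_ge_2)
qed

lemma handshake: "(\<Sum>v\<in>support. deg v) = 2 * card E"
proof -
  have "deg v = card {e \<in> E. v \<in> e}" for v
  proof -
    have "{e \<in> E. v \<in> e} = (\<lambda>w. {v, w}) ` nbs v"
    proof (intro equalityI subsetI)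
      fix e assume e: "e \<in> {e \<in> E. v \<in> e}"
      then have "card e = 2" using two by auto
      then obtain w where "e = {v, w}" using e by (auto simp: card_2_iff)
      then show "e \<in> (\<lambda>w. {v, w}) ` nbs v" using e by (auto simp: nb_def)
    qed (auto simp: nb_def)
    moreover have "inj_on (\<lambda>w. {v, w}) (nbs v)" by (auto simp: inj_on_def doubleton_eq_iff)
    ultimately show ?thesis by (simp add: card_image)
  qed
  then have "(\<Sum>v\<in>support. deg v) = (\<Sum>v\<in>support. card {e \<in> E. v \<in> e})" by simp
  also have "\<dots> = 2 * card E"
  proof (rule sum_multicount)
    show "\<forall>e\<in>E. card {v \<in> support. v \<in> e} = 2"
    proof
      fix e assume e: "e \<in> E"
      then have "{v \<in> support. v \<in> e} = e" by (auto simp: support_def)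
      then show "card {v \<in> support. v \<in> e} = 2" using two[OF e] by simp
    qed
  qed (use finE in auto)
  finally show ?thesis .
qed

text \<open>The amounts fit the deficits of small vertices exactly: 2 * 21 = 102 - 60 and 3 * 4 =
  102 - 90.\<close>

definition gift :: "'a \<Rightarrow> 'a \<Rightarrow> int" where
  "gift v w = (if v \<in> small then 0 else if deg w = 2 then 21 else if deg w = 3 then 4
     else if bad w \<and> \<not> bad v then 3 else 0)"

lemma gift_nonneg: "0 \<le> gift v w"
  by (simp add: gift_def)

lemma gifts_balance: "(\<Sum>v\<in>support. \<Sum>w\<in>nbs v. gift v w) = (\<Sum>v\<in>support. \<Sum>w\<in>nbs v. gift w v)"
proof -
  have n: "nbs v = {w \<in> support. w \<in> nbs v}" for v using nbs_support by auto
  have "(\<Sum>v\<in>support. \<Sum>w\<in>nbs v. gift v w) = (\<Sum>v\<in>support. \<Sum>w\<in>support. if w \<in> nbs v then gift v w else 0)"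
    by (subst n) (simp add: sum.inter_filter)
  also have "\<dots> = (\<Sum>w\<in>support. \<Sum>v\<in>support. if w \<in> nbs v then gift v w else 0)" by (rule sum.swap)
  also have "\<dots> = (\<Sum>w\<in>support. \<Sum>v\<in>support. if v \<in> nbs w then gift v w else 0)" by (simp add: nb_sym)
  also have "\<dots> = (\<Sum>w\<in>support. \<Sum>v\<in>nbs w. gift v w)"
    by (subst (2) n) (simp add: sum.inter_filter)
  finally show ?thesis .
qed

lemma gifts_out:
  assumes "v \<notin> small"
  shows "(\<Sum>w\<in>nbs v. gift v w) = 21 * int (card (twos v)) + 4 * int (card (threes v))
    + (if bad v then 0 else 3 * int (card {w \<in> bigs v. bad w}))"
proof -
  have "(\<Sum>w\<in>nbs v. gift v w) = (\<Sum>w\<in>twos v. gift v w) + (\<Sum>w\<in>threes v. gift v w) + (\<Sum>w\<in>bigs v. gift v w)"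
    using classes_disjoint[of v] by (simp add: nbs_split[of v] sum.union_disjoint)
  also have "(\<Sum>w\<in>twos v. gift v w) = (\<Sum>w\<in>twos v. 21)"
    by (rule sum.cong) (use assms in \<open>auto simp: gift_def twos_def\<close>)
  also have "(\<Sum>w\<in>threes v. gift v w) = (\<Sum>w\<in>threes v. 4)"
    by (rule sum.cong) (use assms in \<open>auto simp: gift_def threes_def\<close>)
  also have "(\<Sum>w\<in>bigs v. gift v w) = (\<Sum>w\<in>bigs v. if bad w \<and> \<not> bad v then 3 else 0)"
    by (rule sum.cong) (use assms in \<open>auto simp: gift_def bigs_def small_def\<close>)
  also have "\<dots> = (if bad v then 0 else 3 * int (card {w \<in> bigs v. bad w}))"
    by (simp add: sum.If_cases Int_def)
  finally show ?thesis by simp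
qed

lemma nbs_small: "v \<in> small \<Longrightarrow> w \<in> nbs v \<Longrightarrow> w \<notin> small"
  using small_indep_small by (auto simp: small_indep_def)

lemma gifts_in_small:
  assumes "v \<in> small" shows "(\<Sum>w\<in>nbs v. gift w v) = (if deg v = 2 then 42 else if deg v = 3 then 12 else 0)"
proof -
  have "(\<Sum>w\<in>nbs v. gift w v) = (\<Sum>w\<in>nbs v. if deg v = 2 then 21 else if deg v = 3 then 4 else 0)"
    by (rule sum.cong) (use assms nbs_small[OF assms] bad_not_small in \<open>auto simp: gift_def\<close>)
  then show ?thesis by simp
qed

lemma gifts_in_bad:
  assumes "bad v" shows "3 * int (card {w \<in> bigs v. \<not> bad w}) \<le> (\<Sum>w\<in>nbs v. gift w v)"
proof -
  have "(\<Sum>w\<in>{w \<in> bigs v. \<not> bad w}. gift w v) \<le> (\<Sum>w\<in>nbs v. gift w v)"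
    by (rule sum_mono2) (auto simp: bigs_def gift_nonneg)
  moreover have "(\<Sum>w\<in>{w \<in> bigs v. \<not> bad w}. gift w v) = (\<Sum>w\<in>{w \<in> bigs v. \<not> bad w}. 3)"
    by (rule sum.cong) (use assms in \<open>auto simp: gift_def bigs_def bad_def bad4_def bad6_def\<close>)
  ultimately show ?thesis by simp
qed

lemma weight_bounds:
  assumes "v \<notin> small"
  shows "card (bigs v) = 0 \<Longrightarrow> 20 \<le> weight small v" "card (bigs v) = 1 \<Longrightarrow> 9 \<le> weight small v"
    "card (bigs v) = 2 \<Longrightarrow> 4 \<le> weight small v"
    "card (bigs v) = 2 \<Longrightarrow> x \<in> bigs v \<Longrightarrow> bad x \<Longrightarrow> 6 \<le> weight small v"
proof -
  \<comment> \<open>Degree at least 4 with at most two big neighbours provides the small neighbour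
    that \<open>reducible_weight\<close> asks for.\<close>
  have "4 \<le> deg v" using assms by (simp add: small_def)
  then have "nbs v \<inter> small \<noteq> {}" if "card (bigs v) \<le> 2"
    using that deg_split[of v] by (auto simp: nbs_inter_small)
  then have "avail (card (bigs v)) \<le> weight small v" if "card (bigs v) \<le> 2"
    using reducible_weight[OF small_indep_small assms] that by (simp add: bigs_def)
  then show "card (bigs v) = 0 \<Longrightarrow> 20 \<le> weight small v" "card (bigs v) = 1 \<Longrightarrow> 9 \<le> weight small v"
    "card (bigs v) = 2 \<Longrightarrow> 4 \<le> weight small v"
    by (auto simp: avail_def)
  assume x: "card (bigs v) = 2" "x \<in> bigs v" "bad x"
  then have "card (bigs v - {x}) = 1" by simp
  then obtain z where "bigs v - {x} = {z}" using card_1_singletonE by blast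
  then have "bigs v = {x, z}" "x \<noteq> z" using x by auto
  then show "6 \<le> weight small v" using weight_bad_neighbour assms x by blast
qed

text \<open>A \<open>bad4\<close> vertex lacks 3 and has a big neighbour that is not bad, by
  \<open>not_three_bad\<close>; a \<open>bad6\<close> vertex lacks 6 and has two, by
  \<open>bigs_bad6\<close>. Other big vertices are treated by their number of big
  neighbours.\<close>

lemma charge_nonneg:
  assumes "v \<in> support"
  shows "0 \<le> 30 * int (deg v) - 102 - (\<Sum>w\<in>nbs v. gift v w) + (\<Sum>w\<in>nbs v. gift w v)"
proof (cases "v \<in> small")
  case True
  then have "(\<Sum>w\<in>nbs v. gift v w) = 0" by (simp add: gift_def)
  moreover have "deg v = 2 \<or> deg v = 3" using True deg_support[OF assms] by (auto simp: small_def)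
  ultimately show ?thesis using gifts_in_small[OF True] by auto
next
  case False
  have split: "card (bigs v) = card {w \<in> bigs v. bad w} + card {w \<in> bigs v. \<not> bad w}"
    by (subst card_Un_disjoint[symmetric]) (auto intro: arg_cong[where f = card])
  have three: "{w \<in> bigs v. \<not> bad w} \<noteq> {}" if "weight small v \<le> 2" "card (bigs v) = 3"
    using not_three_bad[OF False that] by blast
  note deg = deg_split[of v] and w = weight_small[of v]
  show ?thesis
  proof (cases "bad v")
    case True
    have "1 \<le> card {w \<in> bigs v. \<not> bad w}" if "bad4 v"
    proof -
      have "{w \<in> bigs v. \<not> bad w} \<noteq> {}"
        using three that w bad_threes[OF True] by (auto simp: bad4_def)
      then have "card {w \<in> bigs v. \<not> bad w} \<noteq> 0" by auto
      then show ?thesis by linarith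
    qed
    moreover have "card {w \<in> bigs v. \<not> bad w} = 2" if "bad6 v"
    proof -
      have "{w \<in> bigs v. \<not> bad w} = bigs v" using bigs_bad6[OF that] by blast
      then show ?thesis using that by (simp add: bad6_def)
    qed
    ultimately show ?thesis
      using gifts_in_bad[OF True] gifts_out[OF False] True deg unfolding bad_def bad4_def bad6_def by auto
  next
    case nbad: False
    let ?b = "card {w \<in> bigs v. bad w}"
    have in_nonneg: "0 \<le> (\<Sum>w\<in>nbs v. gift w v)" by (simp add: sum_nonneg gift_nonneg)
    have d4: "4 \<le> deg v" using False by (simp add: small_def)
    have b: "?b \<le> card (bigs v)" using split by linarith
    have b2: "6 \<le> weight small v" if "card (bigs v) = 2" "?b \<noteq> 0"
    proof -
      have "{w \<in> bigs v. bad w} \<noteq> {}" using that(2) by auto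
      then show ?thesis using weight_bounds(4)[OF False that(1)] by blast
    qed
    have b3: "?b \<le> 2" if "weight small v \<le> 2" "card (bigs v) = 3"
    proof -
      have "card {w \<in> bigs v. \<not> bad w} \<noteq> 0" using three[OF that] by simp
      then show ?thesis using split that by linarith
    qed
    have n4: "\<not> (card (twos v) = 1 \<and> card (threes v) = 0 \<and> card (bigs v) = 3)"
      "\<not> (card (twos v) = 4 \<and> card (threes v) = 0 \<and> card (bigs v) = 2)"
      using nbad deg by (auto simp: bad_def bad4_def bad6_def)
    \<comment> \<open>This is \<open>30 * deg v - 102\<close> minus all gifts made by
      \<open>v\<close>, with \<open>deg v\<close> split into the three classes of
      neighbours.\<close>
    have "102 + 3 * ?b \<le> 9 * card (twos v) + 26 * card (threes v) + 30 * card (bigs v)"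
    proof -
      consider "card (bigs v) = 0" | "card (bigs v) = 1" | "card (bigs v) = 2" "?b = 0"
        | "card (bigs v) = 2" "?b \<noteq> 0" | "card (bigs v) = 3" | "4 \<le> card (bigs v)" by linarith
      then show ?thesis
      proof cases
        case 1 then show ?thesis using weight_bounds(1)[OF False] w b by linarith
      next
        case 2 then show ?thesis using weight_bounds(2)[OF False] w b by linarith
      next
        case 3
        then have "42 \<le> 9 * card (twos v) + 26 * card (threes v)"
          using weight_bounds(3)[OF False] w n4(2) by (intro charge_arith_two) auto
        then show ?thesis using 3 by linarith
      next
        case 4 then show ?thesis using b2 w b by linarith
      next
        case 5
        then have "12 + 3 * ?b \<le> 9 * card (twos v) + 26 * card (threes v)"
        proof (intro charge_arith_three)
          show "1 \<le> card (twos v) + card (threes v)" using deg d4 5 by linarith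
          show "\<not> (card (twos v) = 1 \<and> card (threes v) = 0)" using n4(1) 5 by blast
          show "?b \<le> 3" using b 5 by linarith
          show "?b \<le> 2" if "card (twos v) + 2 * card (threes v) \<le> 2" using b3 5 w that by linarith
        qed
        then show ?thesis using 5 by linarith
      next
        case 6 then show ?thesis using b by linarith
      qed
    qed
    then show ?thesis using gifts_out[OF False] nbad in_nonneg deg by simp
  qed
qed

text \<open>Gifts cancel in the sum of the final charges, which leaves 60 |E| - 102 |V| nonnegative,
  with V the \<open>support\<close>.\<close>

lemma not_sparse: "support \<noteq> {} \<and> 17 * card support \<le> 10 * card {e \<in> E. e \<subseteq> support}"
proof -
  have "E \<noteq> {}" using uncolourable[of undefined] by (auto simp: valid_def)
  then obtain e where "e \<in> E" by blast
  moreover have "e \<noteq> {}" using two[OF \<open>e \<in> E\<close>] by auto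
  ultimately have "support \<noteq> {}" by (auto simp: support_def)
  have "0 \<le> (\<Sum>v\<in>support. 30 * int (deg v) - 102 - (\<Sum>w\<in>nbs v. gift v w) + (\<Sum>w\<in>nbs v. gift w v))"
    by (intro sum_nonneg charge_nonneg)
  also have "\<dots> = 30 * int (\<Sum>v\<in>support. deg v) - 102 * int (card support)"
    using gifts_balance by (simp add: sum.distrib sum_subtractf sum_distrib_left)
  finally have "17 * card support \<le> 10 * card E" using handshake by linarith
  moreover have "{e \<in> E. e \<subseteq> support} = E" by (auto simp: support_def)
  ultimately show ?thesis using \<open>support \<noteq> {}\<close> by simp
qed

end

section \<open>Colouring sparse graphs\<close>

text \<open>Sparsity passes to subsets of the edges, so the induction hypothesis is the minimality
  required by the locale.\<close>

lemma sparse_colourable: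
  fixes E :: "'a set set"
  assumes "finite E" "\<And>e. e \<in> E \<Longrightarrow> card e = 2"
    and "\<And>X. finite X \<Longrightarrow> X \<noteq> {} \<Longrightarrow> X \<subseteq> \<Union>E \<Longrightarrow> 10 * card {e \<in> E. e \<subseteq> X} < 17 * card X"
  shows "\<exists>c. valid E \<sigma> c"
  using assms
proof (induction E rule: finite_psubset_induct)
  case (psubset E)
  show ?case
  proof (rule ccontr)
    assume n: "\<not> ?case"
    have "minimal_uncolourable E \<sigma>"
    proof
      fix E' assume E': "E' \<subset> E"
      show "\<exists>c. valid E' \<sigma> c"
      proof (rule psubset.IH[OF E'])
        show "card e = 2" if "e \<in> E'" for e using that E' psubset.prems by blast
        show "10 * card {e \<in> E'. e \<subseteq> X} < 17 * card X" if "finite X" "X \<noteq> {}" "X \<subseteq> \<Union>E'" for X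
        proof -
          have "card {e \<in> E'. e \<subseteq> X} \<le> card {e \<in> E. e \<subseteq> X}"
            using E' psubset.hyps by (intro card_mono) auto
          moreover have "10 * card {e \<in> E. e \<subseteq> X} < 17 * card X"
            using that E' by (intro psubset.prems) auto
          ultimately show ?thesis by linarith
        qed
      qed
    qed (use psubset n in auto)
    then interpret minimal_uncolourable E \<sigma> .
    show False using not_sparse psubset.prems(2)[of support] by (auto simp: support_def[symmetric] not_le[symmetric])
  qed
qed

section \<open>Homomorphisms to the signed Paley graph\<close>

fun f3_int :: "f3 \<Rightarrow> int" where
  "f3_int F0 = 0" | "f3_int F1 = 1" | "f3_int F2 = 2"

definition emb :: "pt \<Rightarrow> (int \<times> int) option" where
  "emb = map_option (map_prod f3_int f3_int)"

lemma F9_eq: "F9 = {(0, 0), (0, 1), (0, 2), (1, 0), (1, 1), (1, 2), (2, 0), (2, 1), (2, 2)}"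
proof -
  have "{0..2} = {0, 1, 2 :: int}" by auto
  then show ?thesis by (auto simp: F9_def)
qed

text \<open>The list contains 0 besides the four nonzero squares; differences of distinct elements
  avoid it.\<close>

lemma f9_square_iff: "f9_square x \<longleftrightarrow> x \<in> {(0, 0), (1, 0), (2, 0), (0, 1), (0, 2)}"
  by (auto simp: f9_square_def F9_eq f9_mult_def)

lemma emb_in_V: "emb x \<in> SP9p_V"
proof (cases x)
  case (Some y)
  then obtain a b where "x = Some (a, b)" by (cases y) auto
  then show ?thesis by (cases a; cases b) (simp_all add: emb_def SP9p_V_def F9_eq)
qed (simp add: emb_def SP9p_V_def)

lemma inj_f3_int: "inj f3_int"
proof (rule injI)
  show "x = y" if "f3_int x = f3_int y" for x y using that by (cases x; cases y) auto
qed

lemma emb_neq: "x \<noteq> y \<Longrightarrow> emb x \<noteq> emb y"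
  using option.inj_map[OF prod.inj_map[OF inj_f3_int inj_f3_int]] by (auto simp: emb_def inj_def)

text \<open>An unordered pair may be read in either order, hence the disjunction; the two tests
  agree because -1 is a square.\<close>

lemma SP9p_s_Some:
  "SP9p_s {Some u, Some v} = (if f9_square (f9_sub u v) \<or> f9_square (f9_sub v u) then 1 else -1)"
  by (auto simp: SP9p_s_def doubleton_eq_iff simp del: split_paired_Ex split_paired_All)

lemma SP9p_s_emb:
  assumes "x \<noteq> y" shows "SP9p_s {emb x, emb y} = seidel x y"
proof (cases "x = None \<or> y = None")
  case True
  then show ?thesis using assms by (cases x; cases y) (auto simp: emb_def SP9p_s_def)
next
  case False
  then obtain a b a' b' where xy: "x = Some (a, b)" "y = Some (a', b')" by auto
  show ?thesis using assms unfolding xy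
    by (cases a; cases b; cases a'; cases b')
      (simp_all add: emb_def SP9p_s_Some f9_square_iff f9_sub_def)
qed

text \<open>Switching every vertex of \<open>X\<close> once flips an edge as often as it has ends in
  \<open>X\<close>.\<close>

lemma switch_equiv_set:
  assumes "finite X" "X \<subseteq> V"
  shows "switch_equiv V s (\<lambda>e. s e * (-1) ^ card (e \<inter> X))"
  using assms
proof (induction X rule: finite_induct)
  case empty
  then show ?case by (simp add: switch_equiv.refl)
next
  case (insert v X)
  have "switch_equiv V s (switch v (\<lambda>e. s e * (-1) ^ card (e \<inter> X)))"
    using insert by (intro switch_equiv.step) auto
  moreover have "switch v (\<lambda>e. s e * (-1) ^ card (e \<inter> X)) = (\<lambda>e. s e * (-1) ^ card (e \<inter> insert v X))"
    using insert by (auto simp: switch_def fun_eq_iff Int_insert_right)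
  ultimately show ?case by simp
qed

theorem theorem3:
  fixes V :: "'a set" and E :: "'a set set" and s :: "'a set \<Rightarrow> int"
  assumes "signed_graph V E s"
    and "mad V E < 17 / 5"
  shows "\<exists>\<phi>. signed_hom V E s SP9p_V SP9p_E SP9p_s \<phi>"
proof -
  have finV: "finite V" and EV: "E \<subseteq> {{u, v} | u v. u \<in> V \<and> v \<in> V \<and> u \<noteq> v}"
    and sE: "\<And>e. e \<in> E \<Longrightarrow> s e = 1 \<or> s e = -1"
    using assms(1) by (auto simp: signed_graph_def)
  have "E \<subseteq> Pow V" using EV by auto
  then have finE: "finite E" using finV finite_subset by blast
  let ?M = "{2 * real (card F) / real (card W) | W F. W \<subseteq> V \<and> W \<noteq> {} \<and> F \<subseteq> E \<and> (\<forall>e\<in>F. e \<subseteq> W)}"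
  have "?M \<subseteq> (\<lambda>(W, F). 2 * real (card F) / real (card W)) ` (Pow V \<times> Pow E)" by auto
  then have finM: "finite ?M" using finV finE by (meson finite_Pow_iff finite_SigmaI finite_imageI finite_subset)
  have "\<exists>c. valid E (\<lambda>e. s e = 1) c"
  proof (rule sparse_colourable[OF finE])
    show "card e = 2" if "e \<in> E" for e using that EV by auto
    fix X assume X: "finite X" "X \<noteq> {}" "X \<subseteq> \<Union>E"
    have "X \<subseteq> V" using X \<open>E \<subseteq> Pow V\<close> by auto
    \<comment> \<open>The densest choice of edges on \<open>X\<close>, the induced subgraph, is
      compared with the maximum.\<close>
    then have "2 * real (card {e \<in> E. e \<subseteq> X}) / real (card X) \<in> ?M" using X by blast
    then have "2 * real (card {e \<in> E. e \<subseteq> X}) / real (card X) \<le> mad V E"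
      unfolding mad_def by (rule Max_ge[OF finM])
    then have "2 * real (card {e \<in> E. e \<subseteq> X}) / real (card X) < 17 / 5" using assms(2) by linarith
    moreover have "0 < card X" using X by (simp add: card_gt_0_iff)
    ultimately have "10 * real (card {e \<in> E. e \<subseteq> X}) < 17 * real (card X)" by (simp add: field_simps)
    then show "10 * card {e \<in> E. e \<subseteq> X} < 17 * card X" by linarith
  qed
  then obtain c where c: "valid E (\<lambda>e. s e = 1) c" by blast
  \<comment> \<open>Colours in the switched copy of $SP_9^+$ mark the vertices to be
    switched.\<close>
  define X where "X = {v \<in> V. \<not> snd (c v)}"
  define s' where "s' e = s e * (-1) ^ card (e \<inter> X)" for e
  define \<phi> where "\<phi> v = emb (fst (c v))" for v
  have "switch_equiv V s s'"
    unfolding s'_def by (rule switch_equiv_set) (auto simp: X_def finV)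
  moreover have "{\<phi> u, \<phi> v} \<in> SP9p_E \<and> SP9p_s {\<phi> u, \<phi> v} = s' {u, v}" if e: "{u, v} \<in> E" for u v
  proof -
    have uv: "u \<noteq> v" "u \<in> V" "v \<in> V" using e EV by (auto simp: doubleton_eq_iff)
    have Npos: "c v \<in> Npos (act (s {u, v} = 1) (c u))"
      using c e by (auto simp: valid_def see_def insert_commute)
    then have ne: "fst (c u) \<noteq> fst (c v)" using in_Npos_fst_neq by fastforce
    have "seidel (fst (c u)) (fst (c v)) = s {u, v} * (sg (snd (c u)) * sg (snd (c v)))"
      using Npos sE[OF e] by (auto simp: Npos_def act_def neg_def sg_def split: if_splits)
    also have "sg (snd (c u)) * sg (snd (c v)) = (-1) ^ card ({u, v} \<inter> X)"
      using uv by (auto simp: X_def sg_def Int_insert_left)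
    finally have "seidel (fst (c u)) (fst (c v)) = s' {u, v}" by (simp add: s'_def)
    then show ?thesis
      using SP9p_s_emb[OF ne] emb_neq[OF ne] emb_in_V by (auto simp: \<phi>_def SP9p_E_def)
  qed
  moreover have "\<phi> ` V \<subseteq> SP9p_V" using emb_in_V by (auto simp: \<phi>_def)
  ultimately show ?thesis unfolding signed_hom_def by blast
qed

end
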